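(* Let $1<\alpha<2$, $d\in(0,1-\frac1\alpha)$, $1<p<\alpha$, and let $g:\mathbb{R}\to\mathbb{R}$ be a measurable function such that $g(t)=0$ for all $t<0$ and $|g(t)|\le Ce^{-ct}$ for some constants $C>0$ and $c>0$. Let $Y_d(t)=\int_{-\infty}^{t}(I_+^dg)(t-x)\,dL_\alpha(x)$, $t\in\mathbb{R}$, be the FIMA Stable process and let $M_d$ be the linear fractional stable motion $M_d(t)=\frac{1}{\Gamma(d+1)}\int_{-\infty}^{\infty}[(t-x)_+^d-(-x)_+^d]\,dL_\alpha(x)$, $t\in\mathbb{R}$. Then $Y_d$ can be represented as $$Y_d(t)=\int_{-\infty}^{t}g(t-x)\,dM_d(x),\qquad t\in\mathbb{R}$$ (for each $t$, equality of random variables in $L^p(\Omega,\mathbb P)$).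
   Context: $\{L_\alpha(t)\}_{t\in\mathbb{R}}$ is a symmetric $\alpha$-stable ($S\alpha S$) process with Lebesgue control measure on a probability space $(\Omega,\mathcal F,\mathbb P)$. The stable integral $f\mapsto\int_{\mathbb{R}}f\,dL_\alpha$ is the associated linear map from $L^\alpha(\mathbb{R})$ to random variables, with $\mathbb{E}[\exp\{i\theta\int f\,dL_\alpha\}]=\exp\{-|\theta|^\alpha\int_{\mathbb{R}}|f(x)|^\alpha dx\}$ for $\theta\in\mathbb{R}$; thus $L_\alpha(1)=\int\mathbf 1_{(0,1]}\,dL_\alpha$ has characteristic function $e^{-|\theta|^\alpha}$. Here $u_+=\max\{u,0\}$, and integrals over $(-\infty,t]$ mean integrals over $\mathbb{R}$ of the integrand times $\mathbf 1_{(-\infty,t]}$. The Riemann-Liouville fractional integrals are $(I_-^df)(x)=\frac1{\Gamma(d)}\int_x^\infty f(t)(t-x)^{d-1}dt$ and $(I_+^df)(x)=\frac1{\Gamma(d)}\int_{-\infty}^xf(t)(x-t)^{d-1}dt$. For $f\in L^1(\mathbb{R})\cap L^\alpha(\mathbb{R})$ set $\|f\|_{\alpha,p}=\left(\mathbb{E}|L_\alpha(1)|^p\right)^{1/p}\left(\int_{\mathbb{R}}|(I_-^df)(x)|^\alpha dx\right)^{1/\alpha}$. Integration with respect to $M_d$: for a simple function $\phi=\sum_{i=1}^{n-1}a_i\mathbf 1_{(t_i,t_{i+1}]}$ ($a_i\in\mathbb{R}$, $-\infty<t_1<\dots<t_n<\infty$), $\int_{\mathbb{R}}\phi\,dM_d=\sum_{i=1}^{n-1}a_i[M_d(t_{i+1})-M_d(t_i)]$.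 For $f\in L^1(\mathbb{R})\cap L^\alpha(\mathbb{R})$, $\int_{\mathbb{R}}f\,dM_d$ is the limit in $L^p(\Omega,\mathbb P)$ of $\int_{\mathbb{R}}\phi_n\,dM_d$ for any sequence of simple functions with $\|\phi_n-f\|_{\alpha,p}\to0$ (such sequences exist, and the limit exists and does not depend on the sequence). *)

theory Defs
  imports "HOL-Probability.Probability"
begin

text \<open>Representatives of elements of $L^p(M)$; \<open>M\<close> is \<^term>\<open>lebesgue\<close> (the completed
  measure) for function spaces on the line, and a probability measure for random variables.\<close>

definition Lp_fun :: "'a measure \<Rightarrow> real \<Rightarrow> ('a \<Rightarrow> real) set" where
  "Lp_fun M p = {f \<in> borel_measurable M. integrable M (\<lambda>x. \<bar>f x\<bar> powr p)}"

definition Lp_tendsto :: "'w measure \<Rightarrow> real \<Rightarrow> (nat \<Rightarrow> 'w \<Rightarrow> real) \<Rightarrow> ('w \<Rightarrow> real) \<Rightarrow> bool" where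
  "Lp_tendsto P p X Y \<longleftrightarrow>
     (\<forall>n. X n \<in> Lp_fun P p) \<and> Y \<in> Lp_fun P p \<and>
     (\<lambda>n. \<integral>\<omega>. \<bar>X n \<omega> - Y \<omega>\<bar> powr p \<partial>P) \<longlonglongrightarrow> 0"

text \<open>The last clause expresses the Lebesgue control measure: the increment over $(s,t]$ is
  symmetric $\alpha$-stable with scale parameter $(t-s)^{1/\alpha}$.\<close>

definition SaS_process :: "'w measure \<Rightarrow> real \<Rightarrow> (real \<Rightarrow> 'w \<Rightarrow> real) \<Rightarrow> bool" where
  "SaS_process P \<alpha> L \<longleftrightarrow>
     prob_space P \<and>
     (\<forall>t. L t \<in> borel_measurable P) \<and>
     (AE \<omega> in P. L 0 \<omega> = 0) \<and>
     (\<forall>(n::nat) \<tau>. strict_mono_on {..n} \<tau> \<longrightarrow>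
        prob_space.indep_vars P (\<lambda>_. borel) (\<lambda>i \<omega>. L (\<tau> (Suc i)) \<omega> - L (\<tau> i) \<omega>) {..<n}) \<and>
     (\<forall>s t \<theta>. s < t \<longrightarrow>
        char (distr P borel (\<lambda>\<omega>. L t \<omega> - L s \<omega>)) \<theta> =
          complex_of_real (exp (- (\<bar>\<theta>\<bar> powr \<alpha> * (t - s)))))"

text \<open>\<open>SI\<close> is the stable integral associated with \<open>L\<close>. It is linear as a map into random
  variables modulo almost sure equality, and only its values on $L^\alpha(\mathbb{R})$ are
  constrained. By the last clause together with linearity, it respects almost everywhere
  equality of integrands.\<close>

definition stable_integral ::
    "'w measure \<Rightarrow> real \<Rightarrow> (real \<Rightarrow> 'w \<Rightarrow> real) \<Rightarrow> ((real \<Rightarrow> real) \<Rightarrow> 'w \<Rightarrow> real) \<Rightarrow> bool" where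
  "stable_integral P \<alpha> L SI \<longleftrightarrow>
     (\<forall>f\<in>Lp_fun lebesgue \<alpha>. SI f \<in> borel_measurable P) \<and>
     (\<forall>s t. s < t \<longrightarrow> (AE \<omega> in P. SI (indicator {s<..t}) \<omega> = L t \<omega> - L s \<omega>)) \<and>
     (\<forall>f\<in>Lp_fun lebesgue \<alpha>. \<forall>g\<in>Lp_fun lebesgue \<alpha>. \<forall>a b.
        AE \<omega> in P. SI (\<lambda>x. a * f x + b * g x) \<omega> = a * SI f \<omega> + b * SI g \<omega>) \<and>
     (\<forall>f\<in>Lp_fun lebesgue \<alpha>. \<forall>\<theta>.
        char (distr P borel (SI f)) \<theta> =
          complex_of_real (exp (- (\<bar>\<theta>\<bar> powr \<alpha> * (\<integral>x. \<bar>f x\<bar> powr \<alpha> \<partial>lebesgue)))))"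

definition RL_minus :: "real \<Rightarrow> (real \<Rightarrow> real) \<Rightarrow> real \<Rightarrow> real" where
  "RL_minus d f x = 1 / Gamma d * (LINT t:{x..}|lebesgue. f t * (t - x) powr (d - 1))"

definition RL_plus :: "real \<Rightarrow> (real \<Rightarrow> real) \<Rightarrow> real \<Rightarrow> real" where
  "RL_plus d f x = 1 / Gamma d * (LINT t:{..x}|lebesgue. f t * (x - t) powr (d - 1))"

definition lfsm :: "((real \<Rightarrow> real) \<Rightarrow> 'w \<Rightarrow> real) \<Rightarrow> real \<Rightarrow> real \<Rightarrow> 'w \<Rightarrow> real" where
  "lfsm SI d t \<omega> =
     1 / Gamma (d + 1) * SI (\<lambda>x. (max (t - x) 0) powr d - (max (- x) 0) powr d) \<omega>"

definition fima ::
    "((real \<Rightarrow> real) \<Rightarrow> 'w \<Rightarrow> real) \<Rightarrow> real \<Rightarrow> (real \<Rightarrow> real) \<Rightarrow> real \<Rightarrow> 'w \<Rightarrow> real" where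
  "fima SI d g t = SI (\<lambda>x. RL_plus d g (t - x) * indicator {..t} x)"

definition frac_norm ::
    "'w measure \<Rightarrow> (real \<Rightarrow> 'w \<Rightarrow> real) \<Rightarrow> real \<Rightarrow> real \<Rightarrow> real \<Rightarrow> (real \<Rightarrow> real) \<Rightarrow> real" where
  "frac_norm P L \<alpha> p d f =
     (\<integral>\<omega>. \<bar>L 1 \<omega>\<bar> powr p \<partial>P) powr (1 / p) *
     (\<integral>x. \<bar>RL_minus d f x\<bar> powr \<alpha> \<partial>lebesgue) powr (1 / \<alpha>)"

text \<open>A simple function $\sum_{i=1}^{n-1} a_i 1_{(\tau_i,\tau_{i+1}]}$ is given by its data
  $(n, a, \tau)$.\<close>

type_synonym simple_data = "nat \<times> (nat \<Rightarrow> real) \<times> (nat \<Rightarrow> real)"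

definition simple_data :: "simple_data set" where
  "simple_data = {(n, a, \<tau>). 2 \<le> n \<and> strict_mono_on {1..n} \<tau>}"

definition simple_fun :: "simple_data \<Rightarrow> real \<Rightarrow> real" where
  "simple_fun = (\<lambda>(n, a, \<tau>) x. \<Sum>i\<in>{1..<n}. a i * indicator {\<tau> i<..\<tau> (Suc i)} x)"

definition simple_integral :: "(real \<Rightarrow> 'w \<Rightarrow> real) \<Rightarrow> simple_data \<Rightarrow> 'w \<Rightarrow> real" where
  "simple_integral M = (\<lambda>(n, a, \<tau>) \<omega>. \<Sum>i\<in>{1..<n}. a i * (M (\<tau> (Suc i)) \<omega> - M (\<tau> i) \<omega>))"

definition approx_seq ::
    "'w measure \<Rightarrow> (real \<Rightarrow> 'w \<Rightarrow> real) \<Rightarrow> real \<Rightarrow> real \<Rightarrow> real \<Rightarrow> (real \<Rightarrow> real)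
      \<Rightarrow> (nat \<Rightarrow> simple_data) \<Rightarrow> bool" where
  "approx_seq P L \<alpha> p d f \<phi> \<longleftrightarrow>
     (\<forall>k. \<phi> k \<in> simple_data) \<and>
     (\<lambda>k. frac_norm P L \<alpha> p d (\<lambda>x. simple_fun (\<phi> k) x - f x)) \<longlonglongrightarrow> 0"

text \<open>The integral of $f \in L^1(\mathbb{R}) \cap L^\alpha(\mathbb{R})$ with respect to the linear
  fractional stable motion equals \<open>X\<close> in $L^p(P)$. Existence of an approximating sequence is
  demanded explicitly, so that the condition on all such sequences is never vacuous and
  determines \<open>X\<close> up to almost sure equality.\<close>

definition has_lfsm_integral ::
    "'w measure \<Rightarrow> (real \<Rightarrow> 'w \<Rightarrow> real) \<Rightarrow> ((real \<Rightarrow> real) \<Rightarrow> 'w \<Rightarrow> real) \<Rightarrow> real \<Rightarrow> real \<Rightarrow> real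
      \<Rightarrow> (real \<Rightarrow> real) \<Rightarrow> ('w \<Rightarrow> real) \<Rightarrow> bool" where
  "has_lfsm_integral P L SI \<alpha> p d f X \<longleftrightarrow>
     f \<in> Lp_fun lebesgue 1 \<inter> Lp_fun lebesgue \<alpha> \<and>
     (\<exists>\<phi>. approx_seq P L \<alpha> p d f \<phi>) \<and>
     (\<forall>\<phi>. approx_seq P L \<alpha> p d f \<phi> \<longrightarrow>
        Lp_tendsto P p (\<lambda>k. simple_integral (lfsm SI d) (\<phi> k)) X)"

end

theory Submission
  imports Defs "HOL-Real_Asymp.Real_Asymp"
begin

text \<open>Both \<open>\<integral> \<phi> dM\<^sub>d\<close> for a simple \<open>\<phi>\<close> and the FIMA process are stable integrals of a
  Riemann-Liouville transform: the kernel of \<open>M\<^sub>d(t) - M\<^sub>d(s)\<close> is that transform of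
  \<open>1\<^bsub>(s,t]\<^esub>\<close>, and for \<open>f(x) = g(t - x)\<close>, \<open>x \<le> t\<close>, a reflection gives
  \<open>(I\<^sub>-f)(x) = (I\<^sub>+g)(t - x)\<close>. By stability \<open>SI h\<close> is distributed as
  \<open>\<parallel>h\<parallel>\<^sub>\<alpha> L(1)\<close>, so the \<open>L\<^sup>p\<close> distance of the two integrals is exactly the fractional
  norm of \<open>\<phi> - f\<close>; it is finite because a characteristic function
  \<open>exp (- \<bar>\<theta>\<bar> powr \<alpha>)\<close> forces finite moments of order \<open>p < \<alpha>\<close>. Approximating step functions
  are obtained from the pointwise approximation of \<open>f\<close> by continuous functions, cut down to an
  exponential envelope, by dominated convergence in the transform and then in
  \<open>L\<^sup>\<alpha>\<close>.\<close>

section \<open>Moments of stable laws\<close>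

text \<open>Only the window from \<open>r\<close> to \<open>2 * r\<close>, with
  \<open>r = 1 / \<bar>x\<bar>\<close>, is kept. There \<theta> * |x| lies between 1 and 2, hence
  below pi, so the cosine is at most cos 1, and the weight is at least its value at
  \<open>2 * r\<close>. The window has length \<open>r\<close>, which produces the power
  |x|^p.\<close>

lemma ennreal_abs_powr_le_cosine_transform:
  fixes x p :: real
  assumes "0 < p"
  shows "ennreal ((1 - cos 1) * 2 powr (- 1 - p) * \<bar>x\<bar> powr p)
    \<le> (\<integral>\<^sup>+\<theta>. ennreal ((1 - cos (\<theta> * x)) * \<theta> powr (- 1 - p) * indicator {0<..} \<theta>) \<partial>lborel)"
proof (cases "x = 0")
  case True
  then show ?thesis by simp
next
  case False
  define r where "r = 1 / \<bar>x\<bar>"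
  have r: "r > 0" using False by (simp add: r_def)
  have c1: "cos (1::real) \<le> 1" by simp
  define K where "K = (1 - cos 1) * (2 * r) powr (- 1 - p)"
  have K0: "0 \<le> K" using c1 by (simp add: K_def)
  have bd: "K * indicator {r..2 * r} \<theta> \<le> (1 - cos (\<theta> * x)) * \<theta> powr (- 1 - p) * indicator {0<..} \<theta>" for \<theta>
  proof (cases "\<theta> \<in> {r..2 * r}")
    case True
    have "\<theta> > 0" using True r by auto
    with True have th: "\<theta> > 0" "1 \<le> \<theta> * \<bar>x\<bar>" "\<theta> * \<bar>x\<bar> \<le> 2"
      using r False by (auto simp: r_def field_simps)
    have "cos (\<theta> * x) = cos (\<theta> * \<bar>x\<bar>)"
      by (metis abs_mult abs_of_pos cos_abs_real th(1))
    also have "\<dots> \<le> cos 1"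
      using th pi_ge_two by (intro cos_monotone_0_pi_le) auto
    finally have "1 - cos 1 \<le> 1 - cos (\<theta> * x)" by simp
    moreover have "(2 * r) powr (- 1 - p) \<le> \<theta> powr (- 1 - p)"
      using True th assms by (intro powr_mono2') auto
    ultimately show ?thesis using True th c1 unfolding K_def
      by (auto intro!: mult_mono)
  next
    case False
    then show ?thesis by (auto simp: indicator_def)
  qed
  have "2 powr (- 1 - p) * \<bar>x\<bar> powr p = (2 * r) powr (- 1 - p) * r"
    using r False unfolding r_def
    by (auto simp: powr_mult powr_divide powr_diff powr_minus field_simps)
  then have "ennreal ((1 - cos 1) * 2 powr (- 1 - p) * \<bar>x\<bar> powr p) = ennreal (K * r)"
    unfolding K_def by (simp only: mult.assoc)
  also have "\<dots> = (\<integral>\<^sup>+\<theta>. ennreal K * indicator {r..2 * r} \<theta> \<partial>lborel)"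
    using r K0 by (simp add: nn_integral_cmult_indicator ennreal_mult)
  also have "\<dots> = (\<integral>\<^sup>+\<theta>. ennreal (K * indicator {r..2 * r} \<theta>) \<partial>lborel)"
    by (intro nn_integral_cong) (auto simp: indicator_def)
  also have "\<dots> \<le> (\<integral>\<^sup>+\<theta>. ennreal ((1 - cos (\<theta> * x)) * \<theta> powr (- 1 - p) * indicator {0<..} \<theta>) \<partial>lborel)"
    by (intro nn_integral_mono ennreal_leI bd)
  finally show ?thesis .
qed

text \<open>Improper integrals of powers and exponentials come from the gauge integral and hence for
  the completed measure, while Tonelli and the affine substitutions are applied to
  \<open>lborel\<close>.\<close>

lemma integrable_lebesgue_imp_lborel:
  fixes f :: "real \<Rightarrow> real"
  assumes "integrable lebesgue f" "f \<in> borel_measurable borel"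
  shows "integrable lborel f"
  using assms integrable_completion[of f lborel] by simp

lemma set_integrable_powr_0_1:
  fixes a :: real
  assumes "-1 < a"
  shows "integrable lborel (\<lambda>x. x powr a * indicator {0<..1} x)"
proof -
  have "(\<lambda>x. x powr a) absolutely_integrable_on {0..1}"
    using has_integral_powr_from_0[OF assms, of 1]
    by (intro nonnegative_absolutely_integrable_1) (auto simp: integrable_on_def)
  then have "integrable lebesgue (\<lambda>x. indicator {0..1} x *\<^sub>R x powr a)"
    by (simp add: set_integrable_def)
  \<comment> \<open>The two indicators differ only at 0, where \<open>x powr a\<close> is 0 by
    convention for every exponent.\<close>
  also have "(\<lambda>x. indicator {0..1} x *\<^sub>R x powr a) = (\<lambda>x. x powr a * indicator {0<..1} x)"
  proof
    fix x :: real
    show "indicator {0..1} x *\<^sub>R x powr a = x powr a * indicator {0<..1} x"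
      by (cases "x = 0") (auto simp: indicator_def)
  qed
  finally show ?thesis by (rule integrable_lebesgue_imp_lborel) measurable
qed

lemma set_integrable_powr_1_inf:
  fixes a :: real
  assumes "a < -1"
  shows "integrable lborel (\<lambda>x. x powr a * indicator {1<..} x)"
proof -
  have "(\<lambda>x. x powr a) absolutely_integrable_on {1..}"
    using has_integral_powr_to_inf[OF assms, of 1]
    by (intro nonnegative_absolutely_integrable_1) (auto simp: integrable_on_def)
  then have "integrable lebesgue (\<lambda>x. indicator {1..} x *\<^sub>R x powr a)"
    by (simp add: set_integrable_def)
  then have "integrable lborel (\<lambda>x. indicator {1..} x *\<^sub>R x powr a)"
    by (rule integrable_lebesgue_imp_lborel) measurable
  then have "integrable lborel (\<lambda>x. indicator {1<..} x *\<^sub>R (indicator {1..} x *\<^sub>R x powr a))"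
    by (rule integrable_mult_indicator[rotated]) simp
  also have "(\<lambda>x. indicator {1<..} x *\<^sub>R (indicator {1..} x *\<^sub>R x powr a)) = (\<lambda>x. x powr a * indicator {1<..} x)"
    by (auto simp: indicator_def)
  finally show ?thesis .
qed

lemma (in real_distribution) integral_cos_eq_Re_char:
  "(\<integral>x. cos (\<theta> * x) \<partial>M) = Re (char M \<theta>)"
proof -
  have "integrable M (\<lambda>x. iexp (\<theta> * x))"
    by (intro integrable_const_bound[where B=1]) auto
  then have "Re (char M \<theta>) = (\<integral>x. Re (iexp (\<theta> * x)) \<partial>M)"
    unfolding char_def by (simp add: integral_Re)
  then show ?thesis by (simp add: Re_exp)
qed

text \<open>Integrate the pointwise bound \<open>\<bar>x\<bar>\<^sup>p \<lesssim> \<integral>\<^sub>0\<^sup>\<infinity> (1 - cos (\<theta> x)) \<theta>\<^sup>-\<^sup>1\<^sup>-\<^sup>p d\<theta>\<close> over \<open>M\<close> and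
  exchange the integrals: near \<open>0\<close> the integrand is \<open>O(\<theta> powr (\<alpha> - 1 - p))\<close>.\<close>

lemma integrable_abs_powr_of_stable:
  assumes "real_distribution M" and "0 < p" "p < \<alpha>"
    and ch: "\<And>\<theta>. char M \<theta> = complex_of_real (exp (- (\<bar>\<theta>\<bar> powr \<alpha>)))"
  shows "integrable M (\<lambda>x. \<bar>x\<bar> powr p)"
proof -
  interpret real_distribution M by fact
  interpret pair_sigma_finite M lborel ..
  define K :: real where "K = (1 - cos 1) * 2 powr (- 1 - p)"
  have "cos 1 < cos (0::real)"
    using pi_ge_two by (intro cos_monotone_0_pi) auto
  then have K: "K > 0" by (simp add: K_def)
  define w where "w = (\<lambda>\<theta>::real. \<theta> powr (- 1 - p) * indicator {0<..} \<theta>)"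
  have w0: "w \<theta> \<ge> 0" for \<theta> by (simp add: w_def)
  have wm[measurable]: "w \<in> borel_measurable borel" unfolding w_def by measurable
  have "(\<integral>\<^sup>+x. ennreal (K * \<bar>x\<bar> powr p) \<partial>M) \<le> (\<integral>\<^sup>+x. (\<integral>\<^sup>+\<theta>. ennreal ((1 - cos (\<theta> * x)) * w \<theta>) \<partial>lborel) \<partial>M)"
    using ennreal_abs_powr_le_cosine_transform[OF \<open>0 < p\<close>]
    by (intro nn_integral_mono) (simp add: K_def w_def mult.assoc)
  also have "\<dots> = (\<integral>\<^sup>+\<theta>. (\<integral>\<^sup>+x. ennreal ((1 - cos (\<theta> * x)) * w \<theta>) \<partial>M) \<partial>lborel)"
    by (rule Fubini'[symmetric]) measurable
  also have "\<dots> = (\<integral>\<^sup>+\<theta>. ennreal ((1 - exp (- (\<bar>\<theta>\<bar> powr \<alpha>))) * w \<theta>) \<partial>lborel)"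
  proof (intro nn_integral_cong)
    fix \<theta> :: real
    have i: "integrable M (\<lambda>x. cos (\<theta> * x))"
      by (intro integrable_const_bound[where B=1]) auto
    have "(\<integral>\<^sup>+x. ennreal ((1 - cos (\<theta> * x)) * w \<theta>) \<partial>M) = ennreal (\<integral>x. (1 - cos (\<theta> * x)) * w \<theta> \<partial>M)"
      using i w0 by (intro nn_integral_eq_integral) auto
    also have "(\<integral>x. (1 - cos (\<theta> * x)) * w \<theta> \<partial>M) = (1 - exp (- (\<bar>\<theta>\<bar> powr \<alpha>))) * w \<theta>"
      using i prob_space by (simp add: integral_cos_eq_Re_char ch)
    finally show "(\<integral>\<^sup>+x. ennreal ((1 - cos (\<theta> * x)) * w \<theta>) \<partial>M) = \<dots>" .
  qed
  \<comment> \<open>Of the bounds 1 - exp (- s) \<le> s and 1 - exp (- s) \<le> 1, the first is used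
    for \<theta> up to 1 and the second beyond. The resulting powers are integrable because p <
    \<alpha> and 0 < p respectively.\<close>
  also have "\<dots> \<le> (\<integral>\<^sup>+\<theta>. ennreal (\<theta> powr (\<alpha> - 1 - p) * indicator {0<..1} \<theta> + \<theta> powr (- 1 - p) * indicator {1<..} \<theta>) \<partial>lborel)"
  proof (intro nn_integral_mono ennreal_leI)
    fix \<theta> :: real
    have "1 - exp (- (\<bar>\<theta>\<bar> powr \<alpha>)) \<le> \<bar>\<theta>\<bar> powr \<alpha>"
      using exp_ge_add_one_self[of "- (\<bar>\<theta>\<bar> powr \<alpha>)"] by simp
    then have *: "(1 - exp (- (\<bar>\<theta>\<bar> powr \<alpha>))) * \<theta> powr (- 1 - p) \<le> \<bar>\<theta>\<bar> powr \<alpha> * \<theta> powr (- 1 - p)"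
      by (intro mult_right_mono) auto
    have **: "(1 - exp (- (\<bar>\<theta>\<bar> powr \<alpha>))) * \<theta> powr (- 1 - p) \<le> 1 * \<theta> powr (- 1 - p)"
      by (intro mult_right_mono) auto
    have ***: "\<theta> > 0 \<Longrightarrow> \<bar>\<theta>\<bar> powr \<alpha> * \<theta> powr (- 1 - p) = \<theta> powr (\<alpha> - 1 - p)"
      by (simp add: powr_add[symmetric] diff_diff_eq add_diff_eq)
    show "(1 - exp (- (\<bar>\<theta>\<bar> powr \<alpha>))) * w \<theta> \<le> \<theta> powr (\<alpha> - 1 - p) * indicator {0<..1} \<theta> + \<theta> powr (- 1 - p) * indicator {1<..} \<theta>"
      using * ** *** by (auto simp: w_def indicator_def)
  qed
  also have "\<dots> < \<infinity>"
  proof -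
    have "integrable lborel (\<lambda>\<theta>. \<theta> powr (\<alpha> - 1 - p) * indicator {0<..1} \<theta> + \<theta> powr (- 1 - p) * indicator {1<..} \<theta>)"
      using assms by (intro Bochner_Integration.integrable_add set_integrable_powr_0_1 set_integrable_powr_1_inf) auto
    then show ?thesis by (subst nn_integral_eq_integral) auto
  qed
  finally have "(\<integral>\<^sup>+x. ennreal (K * \<bar>x\<bar> powr p) \<partial>M) < \<infinity>" .
  then have "integrable M (\<lambda>x. K * \<bar>x\<bar> powr p)"
    using K by (intro integrableI_nonneg) auto
  then show ?thesis using K by simp
qed

section \<open>The right-sided Riemann-Liouville integral\<close>

text \<open>A divergent Bochner integral has the default value 0, so additivity of
  \<open>RL_minus\<close> has to be earned. Convergence is asked at every point, not almost
  everywhere, so that the identities below hold as equalities of functions and can be rewritten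
  inside \<open>SI\<close>.\<close>

definition RL_integrable :: "real \<Rightarrow> (real \<Rightarrow> real) \<Rightarrow> bool" where
  "RL_integrable d f \<longleftrightarrow> (\<forall>x. set_integrable lebesgue {x..} (\<lambda>u. f u * (u - x) powr (d - 1)))"

lemma RL_minus_cmult: "RL_minus d (\<lambda>x. a * f x) x = a * RL_minus d f x"
  by (simp add: RL_minus_def mult.assoc)

lemma RL_minus_diff:
  assumes "RL_integrable d f" "RL_integrable d h"
  shows "RL_minus d (\<lambda>x. f x - h x) x = RL_minus d f x - RL_minus d h x"
  using assms unfolding RL_minus_def RL_integrable_def
  by (simp add: left_diff_distrib set_integral_diff diff_divide_distrib)

lemma RL_integrable_sum:
  assumes "\<And>i. i \<in> I \<Longrightarrow> RL_integrable d (f i)"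
  shows "RL_integrable d (\<lambda>x. \<Sum>i\<in>I. f i x)"
  using assms unfolding RL_integrable_def set_integrable_def
  by (simp add: sum_distrib_right sum_distrib_left)

lemma RL_integrable_cmult:
  assumes "RL_integrable d f"
  shows "RL_integrable d (\<lambda>x. a * f x)"
  using assms unfolding RL_integrable_def by (simp add: mult.assoc)

lemma RL_minus_sum:
  assumes "\<And>i. i \<in> I \<Longrightarrow> RL_integrable d (f i)"
  shows "RL_minus d (\<lambda>x. \<Sum>i\<in>I. f i x) x = (\<Sum>i\<in>I. RL_minus d (f i) x)"
proof -
  have "(LINT u:{x..}|lebesgue. (\<Sum>i\<in>I. f i u) * (u - x) powr (d - 1))
    = (\<Sum>i\<in>I. LINT u:{x..}|lebesgue. f i u * (u - x) powr (d - 1))"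
    using assms unfolding set_lebesgue_integral_def RL_integrable_def set_integrable_def
    by (subst Bochner_Integration.integral_sum[symmetric]) (auto simp: sum_distrib_right sum_distrib_left)
  then show ?thesis by (simp add: RL_minus_def sum_distrib_left)
qed

text \<open>Replacing \<open>f\<close> by a Borel function equal to it almost everywhere changes no
  value of the transform. The kernel is then jointly Borel in both variables, and a parameter
  integral over the sigma-finite \<open>lborel\<close> is Borel in the parameter.\<close>

lemma borel_measurable_RL_minus:
  assumes f: "f \<in> borel_measurable lebesgue"
  shows "RL_minus d f \<in> borel_measurable borel"
proof -
  obtain f' where f'[measurable]: "f' \<in> borel_measurable borel" and ae: "AE x in lborel. f x = f' x"
    using completion_ex_borel_measurable_real[OF f] by auto
  have ae': "AE x in lebesgue. f x = f' x"
    using ae by (rule AE_completion)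
  have "RL_minus d f x = 1 / Gamma d * (\<integral>u. indicator {x..} u *\<^sub>R (f' u * (u - x) powr (d - 1)) \<partial>lborel)" for x
  proof -
    have m: "(\<lambda>u. indicator {x..} u *\<^sub>R (f' u * (u - x) powr (d - 1))) \<in> borel_measurable borel"
      by measurable
    have "(\<integral>u. indicator {x..} u *\<^sub>R (f u * (u - x) powr (d - 1)) \<partial>lebesgue)
        = (\<integral>u. indicator {x..} u *\<^sub>R (f' u * (u - x) powr (d - 1)) \<partial>lebesgue)"
    proof (rule integral_cong_AE)
      have [measurable]: "(\<lambda>u. indicator {x..} u * (u - x) powr (d - 1)) \<in> borel_measurable lebesgue"
        by (intro measurable_completion) measurable
      have "(\<lambda>u. f u * (indicator {x..} u * (u - x) powr (d - 1))) \<in> borel_measurable lebesgue"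
        using f by measurable
      then show "(\<lambda>u. indicator {x..} u *\<^sub>R (f u * (u - x) powr (d - 1))) \<in> borel_measurable lebesgue"
        by (simp add: mult_ac)
      show "(\<lambda>u. indicator {x..} u *\<^sub>R (f' u * (u - x) powr (d - 1))) \<in> borel_measurable lebesgue"
        using m by (intro measurable_completion) simp
      show "AE u in lebesgue. indicator {x..} u *\<^sub>R (f u * (u - x) powr (d - 1))
        = indicator {x..} u *\<^sub>R (f' u * (u - x) powr (d - 1))"
        using ae' by eventually_elim simp
    qed
    also have "\<dots> = (\<integral>u. indicator {x..} u *\<^sub>R (f' u * (u - x) powr (d - 1)) \<partial>lborel)"
      using m by (intro integral_completion) simp
    finally show ?thesis by (simp add: RL_minus_def set_lebesgue_integral_def)
  qed
  then have "RL_minus d f = (\<lambda>x. 1 / Gamma d * (\<integral>u. (if x \<le> u then f' u * (u - x) powr (d - 1) else 0) \<partial>lborel))"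
    by (auto simp: fun_eq_iff indicator_def intro!: arg_cong2[where f="(*)"] Bochner_Integration.integral_cong)
  also have "\<dots> \<in> borel_measurable borel"
    by measurable
  finally show ?thesis .
qed

text \<open>For d < 1 and s = x the integrand blows up at the left end, so the primitive is
  differentiated only in the interior. It is continuous up to the endpoint because 0 < d.\<close>

lemma has_integral_shifted_powr:
  fixes d s t x :: real
  assumes "0 < d" "x \<le> s" "s \<le> t"
  shows "((\<lambda>u. (u - x) powr (d - 1)) has_integral ((t - x) powr d / d - (s - x) powr d / d)) {s..t}"
proof (rule fundamental_theorem_of_calculus_interior)
  show "continuous_on {s..t} (\<lambda>u. (u - x) powr d / d)"
    using assms by (intro continuous_on_divide continuous_on_powr' continuous_intros) auto
  show "((\<lambda>u. (u - x) powr d / d) has_vector_derivative (u - x) powr (d - 1)) (at u)" if "u \<in> {s<..<t}" for u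
    using that assms unfolding has_real_derivative_iff_has_vector_derivative[symmetric]
    by (auto intro!: derivative_eq_intros)
qed fact

text \<open>This identifies the kernel of an increment of linear fractional stable motion. The
  primitive of the power is evaluated between max s x and t, and d * Gamma d = Gamma (d + 1). For x
  > t both truncated terms vanish since \<open>0 powr d = 0\<close>.\<close>

lemma RL_minus_indicator:
  fixes d s t x :: real
  assumes d: "0 < d" and "s \<le> t"
  shows "RL_minus d (indicator {s<..t}) x
    = ((max (t - x) 0) powr d - (max (s - x) 0) powr d) / Gamma (d + 1)"
proof -
  have G: "Gamma (d + 1) = d * Gamma d"
    using d by (intro Gamma_plus1) (auto dest: nonpos_Ints_nonpos)
  have eq: "(LINT u:{x..}|lebesgue. indicator {s<..t} u * (u - x) powr (d - 1))
     = (LINT u:{max s x..t}|lebesgue. (u - x) powr (d - 1))"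
    unfolding set_lebesgue_integral_def
  proof (rule integral_cong_AE)
    show "AE u in lebesgue. indicator {x..} u *\<^sub>R (indicator {s<..t} u * (u - x) powr (d - 1))
      = indicator {max s x..t} u *\<^sub>R (u - x) powr (d - 1)"
    proof -
      have "AE u in lebesgue. u \<noteq> s"
        by (intro AE_completion) (rule AE_lborel_singleton)
      then show ?thesis by eventually_elim (auto simp: indicator_def)
    qed
  qed (intro measurable_completion; measurable)+
  show ?thesis
  proof (cases "max s x \<le> t")
    case True
    have I: "((\<lambda>u. (u - x) powr (d - 1)) has_integral ((t - x) powr d / d - (max s x - x) powr d / d)) {max s x..t}"
      using True by (intro has_integral_shifted_powr d) auto
    have "(\<lambda>u. (u - x) powr (d - 1)) absolutely_integrable_on {max s x..t}"
      using I by (intro nonnegative_absolutely_integrable_1) (auto simp: integrable_on_def)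
    from set_lebesgue_integral_eq_integral(2)[OF this] I
    have "(LINT u:{max s x..t}|lebesgue. (u - x) powr (d - 1)) = (t - x) powr d / d - (max s x - x) powr d / d"
      by (simp add: integral_unique)
    moreover have "max s x - x = max (s - x) 0" "t - x = max (t - x) 0" using True by auto
    ultimately show ?thesis
      unfolding RL_minus_def eq G by (simp add: diff_divide_distrib)
  next
    case False
    then have "{max s x..t} = {}" "t < x" using \<open>s \<le> t\<close> by auto
    then show ?thesis using \<open>s \<le> t\<close>
      unfolding RL_minus_def eq by (simp add: set_lebesgue_integral_def)
  qed
qed

text \<open>Substitute v = t - u. The cutoff at u \<le> t corresponds to v \<ge> 0, which costs
  nothing because \<open>g\<close> vanishes on the negative axis. For x > t both sides are
  0.\<close>

lemma RL_minus_reflect: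
  assumes g: "g \<in> borel_measurable lebesgue" and g0: "\<And>v. v < 0 \<Longrightarrow> g v = 0"
  shows "RL_minus d (\<lambda>u. g (t - u) * indicator {..t} u) x = RL_plus d g (t - x) * indicator {..t} x"
proof (cases "x \<le> t")
  case False
  then have "(LINT u:{x..}|lebesgue. g (t - u) * indicator {..t} u * (u - x) powr (d - 1)) = 0"
    unfolding set_lebesgue_integral_def
    by (intro integral_eq_zero_AE AE_I2) (auto simp: indicator_def)
  then show ?thesis using False by (simp add: RL_minus_def)
next
  case True
  define h where "h = (\<lambda>v. indicator {..t - x} v *\<^sub>R (g v * (t - x - v) powr (d - 1)))"
  have [measurable]: "(\<lambda>v. indicator {..t - x} v * (t - x - v) powr (d - 1)) \<in> borel_measurable lebesgue"
    by (intro measurable_completion) measurable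
  have "(\<lambda>v. g v * (indicator {..t - x} v * (t - x - v) powr (d - 1))) \<in> borel_measurable lebesgue"
    using g by measurable
  then have h: "h \<in> borel_measurable lebesgue"
    by (simp add: h_def mult_ac)
  have m: "(\<lambda>u. t + - 1 * u) \<in> lebesgue \<rightarrow>\<^sub>M (lebesgue :: real measure)"
    using lebesgue_affine_measurable[where c="\<lambda>_::real. -1" and t=t] by simp
  \<comment> \<open>A reflection followed by a translation preserves Lebesgue measure: the Jacobian
    factor is |-1| = 1.\<close>
  have "integral\<^sup>L lebesgue h = integral\<^sup>L (density (distr lebesgue lebesgue (\<lambda>u. t + - 1 * u)) (\<lambda>_. ennreal \<bar>-1\<bar>)) h"
    using lebesgue_real_affine[of "-1" t] by simp
  also have "\<dots> = integral\<^sup>L (distr lebesgue lebesgue (\<lambda>u. t + - 1 * u)) h"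
    by (simp add: density_1)
  also have "\<dots> = (\<integral>u. h (t + - 1 * u) \<partial>lebesgue)"
    by (rule integral_distr[OF m h])
  also have "(\<lambda>u. h (t + - 1 * u)) = (\<lambda>u. indicator {x..} u *\<^sub>R (g (t - u) * indicator {..t} u * (u - x) powr (d - 1)))"
    using g0 by (auto simp: h_def indicator_def fun_eq_iff)
  finally show ?thesis using True
    by (simp add: RL_minus_def RL_plus_def set_lebesgue_integral_def h_def)
qed

section \<open>Envelope for transforms of exponentially decaying integrands\<close>

definition RL_envelope :: "real \<Rightarrow> real \<Rightarrow> real" where
  "RL_envelope d y = indicator {0<..1} y + y powr (d - 1) * indicator {1<..} y"

lemma borel_measurable_RL_envelope [measurable]: "RL_envelope d \<in> borel_measurable borel"
  unfolding RL_envelope_def by measurable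

lemma RL_envelope_nonneg: "0 \<le> RL_envelope d y"
  by (simp add: RL_envelope_def)

text \<open>The envelope is bounded on (0,1] and has the tail y^(d-1), so the only condition is at
  infinity. The hypothesis on the exponent is d < 1 - 1/\<alpha> in another form.\<close>

lemma integrable_RL_envelope_powr:
  assumes "0 < \<alpha>" "\<alpha> * (d - 1) < -1"
  shows "integrable lebesgue (\<lambda>x. RL_envelope d (t - x) powr \<alpha>)"
proof -
  \<comment> \<open>Writing the constant 1 on (0,1] as a power with exponent 0 makes it a case of
    integrable powers near 0.\<close>
  have "integrable lborel (\<lambda>y. y powr 0 * indicator {0<..1} y + y powr (\<alpha> * (d - 1)) * indicator {1<..} y)"
    using assms by (intro Bochner_Integration.integrable_add set_integrable_powr_0_1 set_integrable_powr_1_inf) auto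
  also have "(\<lambda>y. y powr 0 * indicator {0<..1} y + y powr (\<alpha> * (d - 1)) * indicator {1<..} y)
      = (\<lambda>y. RL_envelope d y powr \<alpha>)"
    using assms by (auto simp: RL_envelope_def indicator_def powr_powr mult.commute fun_eq_iff)
  finally have "integrable lborel (\<lambda>x. RL_envelope d (t + - 1 * x) powr \<alpha>)"
    by (rule lborel_integrable_real_affine) simp
  then show ?thesis
    by (subst integrable_completion) simp_all
qed

text \<open>A consequence of s \<le> exp s at s = c * y / 2. It trades one factor y for a constant
  and so lowers y^d to the envelope tail y^(d-1).\<close>

lemma exp_decay_le_inverse:
  fixes c y :: real
  assumes "0 < c" "0 < y"
  shows "exp (- (c * y / 2)) * y \<le> 2 / c"
proof -
  have "c * y / 2 \<le> exp (c * y / 2)"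
    using exp_ge_add_one_self[of "c * y / 2"] by linarith
  then show ?thesis using assms by (simp add: exp_minus field_simps)
qed

lemma set_integrable_shifted_powr:
  fixes d x t :: real
  assumes "0 < d"
  shows "set_integrable lebesgue {x..t} (\<lambda>u. (u - x) powr (d - 1))"
proof (cases "x \<le> t")
  case True
  then show ?thesis
    using has_integral_shifted_powr[OF assms order_refl True]
    by (intro nonnegative_absolutely_integrable_1) (auto simp: integrable_on_def)
qed (simp add: set_integrable_def)

lemma set_integrable_exp_kernel:
  fixes c d x t :: real
  assumes "0 < d" "0 < c"
  shows "set_integrable lebesgue {x..t} (\<lambda>u. exp (- c * (t - u)) * (u - x) powr (d - 1))"
proof (rule set_integrable_bound[OF set_integrable_shifted_powr[OF assms(1)]])
  show "set_borel_measurable lebesgue {x..t} (\<lambda>u. exp (- c * (t - u)) * (u - x) powr (d - 1))"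
    unfolding set_borel_measurable_def by (intro measurable_completion) measurable
qed (use assms in \<open>auto intro!: mult_left_le_one_le\<close>)

text \<open>Let y = t - x. For y \<le> 1 the exponential is dropped, which gives the summand 1 / d.
  For y > 1 the half of the interval near t gives 2^(1-d) / c and the half near x gives 2 / (c * d).
  The summands are added so that one constant covers both ranges.\<close>

lemma exp_kernel_bound:
  fixes c d x t :: real
  assumes d: "0 < d" "d < 1" and c: "0 < c"
  shows "(LINT u:{x..t}|lebesgue. exp (- c * (t - u)) * (u - x) powr (d - 1))
    \<le> (1 / d + 2 powr (1 - d) / c + 2 / (c * d)) * RL_envelope d (t - x)"
proof (cases "x < t")
  case False
  have "(LINT u:{x..t}|lebesgue. exp (- c * (t - u)) * (u - x) powr (d - 1)) = 0"
    unfolding set_lebesgue_integral_def using False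
    by (intro integral_eq_zero_AE AE_I2) (auto simp: indicator_def)
  also have "\<dots> \<le> (1 / d + 2 powr (1 - d) / c + 2 / (c * d)) * RL_envelope d (t - x)"
    using d c by (simp add: RL_envelope_nonneg)
  finally show ?thesis .
next
  case True
  define y where "y = t - x"
  have y: "y > 0" using True by (simp add: y_def)
  let ?k = "\<lambda>u. exp (- c * (t - u)) * (u - x) powr (d - 1)"
  note ki = set_integrable_exp_kernel[OF d(1) c, of x t]
  have powi: "set_integrable lebesgue {x..t} (\<lambda>u. (u - x) powr (d - 1))"
    by (rule set_integrable_shifted_powr[OF d(1)])
  have powv: "(LINT u:{x..t}|lebesgue. (u - x) powr (d - 1)) = y powr d / d"
    using set_lebesgue_integral_eq_integral(2)[OF powi] has_integral_shifted_powr[OF d(1) order_refl, of x t] True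
    by (simp add: integral_unique y_def)
  have eh: "((\<lambda>u. exp (- c * (t - u))) has_integral (exp (- c * (t - t)) / c - exp (- c * (t - x)) / c)) {x..t}"
  proof (rule fundamental_theorem_of_calculus)
    show "((\<lambda>u. exp (- c * (t - u)) / c) has_vector_derivative exp (- c * (t - u))) (at u within {x..t})" for u
      unfolding has_real_derivative_iff_has_vector_derivative[symmetric]
      using c by (auto intro!: derivative_eq_intros)
  qed (use True in simp)
  have ei: "set_integrable lebesgue {x..t} (\<lambda>u. exp (- c * (t - u)))"
    using eh by (intro nonnegative_absolutely_integrable_1) (auto simp: integrable_on_def)
  have ev: "(LINT u:{x..t}|lebesgue. exp (- c * (t - u))) \<le> 1 / c"
    using set_lebesgue_integral_eq_integral(2)[OF ei] eh c by (simp add: integral_unique)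
  have b1: "(LINT u:{x..t}|lebesgue. ?k u) \<le> y powr d / d"
    unfolding powv[symmetric]
    using c by (intro set_integral_mono ki powi) (auto intro!: mult_left_le_one_le)
  \<comment> \<open>On the half near \<open>x\<close> the exponential is small, on the half near \<open>t\<close> the power is at most
    its value at distance \<open>y / 2\<close>.\<close>
  have m: "?k u \<le> (y / 2) powr (d - 1) * exp (- c * (t - u)) + exp (- (c * y / 2)) * (u - x) powr (d - 1)"
    if u: "u \<in> {x..t}" for u
  proof (cases "u - x \<le> y / 2")
    case True
    then have "y / 2 \<le> t - u" by (simp add: y_def field_simps)
    then have "c * (y / 2) \<le> c * (t - u)" using c by (intro mult_left_mono) auto
    then have "- c * (t - u) \<le> - (c * y / 2)" by simp
    then have "?k u \<le> exp (- (c * y / 2)) * (u - x) powr (d - 1)"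
      by (intro mult_right_mono) auto
    then show ?thesis by (simp add: add_increasing)
  next
    case False
    then have "(u - x) powr (d - 1) \<le> (y / 2) powr (d - 1)"
      using d y by (intro powr_mono2') auto
    then have "?k u \<le> (y / 2) powr (d - 1) * exp (- c * (t - u))"
      by (simp add: mult.commute)
    then show ?thesis by (simp add: add_increasing2)
  qed
  have i1: "set_integrable lebesgue {x..t} (\<lambda>u. (y / 2) powr (d - 1) * exp (- c * (t - u)))"
    using ei by (rule set_integrable_mult_right)
  have i2: "set_integrable lebesgue {x..t} (\<lambda>u. exp (- (c * y / 2)) * (u - x) powr (d - 1))"
    using powi by (rule set_integrable_mult_right)
  have "(LINT u:{x..t}|lebesgue. ?k u) \<le> (LINT u:{x..t}|lebesgue.
      (y / 2) powr (d - 1) * exp (- c * (t - u)) + exp (- (c * y / 2)) * (u - x) powr (d - 1))"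
    by (rule set_integral_mono[OF ki set_integral_add(1)[OF i1 i2] m])
  also have "\<dots> = (y / 2) powr (d - 1) * (LINT u:{x..t}|lebesgue. exp (- c * (t - u)))
      + exp (- (c * y / 2)) * (y powr d / d)"
    unfolding set_integral_add(2)[OF i1 i2] by (simp add: powv)
  also have "\<dots> \<le> (y / 2) powr (d - 1) * (1 / c) + (2 / c * y powr (d - 1)) / d"
  proof (rule add_mono)
    show "(y / 2) powr (d - 1) * (LINT u:{x..t}|lebesgue. exp (- c * (t - u))) \<le> (y / 2) powr (d - 1) * (1 / c)"
      by (rule mult_left_mono[OF ev]) simp
    have "exp (- (c * y / 2)) * y * y powr (d - 1) \<le> 2 / c * y powr (d - 1)"
      by (rule mult_right_mono[OF exp_decay_le_inverse[OF c y]]) simp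
    moreover have "y powr d = y * y powr (d - 1)"
      using y by (simp add: powr_mult_base)
    ultimately show "exp (- (c * y / 2)) * (y powr d / d) \<le> 2 / c * y powr (d - 1) / d"
      using divide_right_mono[of "exp (- (c * y / 2)) * y * y powr (d - 1)" "2 / c * y powr (d - 1)" d] d
      by (simp only: mult.assoc times_divide_eq_right less_imp_le)
  qed
  also have "\<dots> = (2 powr (1 - d) / c + 2 / (c * d)) * y powr (d - 1)"
  proof -
    have "(y / 2) powr (d - 1) = 2 powr (1 - d) * y powr (d - 1)"
      using y powr_minus_divide[of 2 "d - 1"] by (simp add: powr_divide)
    then show ?thesis by (simp add: distrib_right)
  qed
  finally have b2: "(LINT u:{x..t}|lebesgue. ?k u) \<le> (2 powr (1 - d) / c + 2 / (c * d)) * y powr (d - 1)" .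
  show ?thesis
  proof (cases "y \<le> 1")
    case True
    have "y powr d \<le> 1" using True y d by (simp add: powr_le1)
    then have "y powr d / d \<le> 1 / d" using d by (simp add: divide_right_mono)
    also have "\<dots> \<le> 1 / d + 2 powr (1 - d) / c + 2 / (c * d)" using d c by simp
    finally show ?thesis using b1 True y unfolding y_def[symmetric] by (simp add: RL_envelope_def)
  next
    case False
    have "(2 powr (1 - d) / c + 2 / (c * d)) * y powr (d - 1)
      \<le> (1 / d + 2 powr (1 - d) / c + 2 / (c * d)) * y powr (d - 1)"
      using d by (intro mult_right_mono) auto
    with b2 have "(LINT u:{x..t}|lebesgue. ?k u) \<le> \<dots>" by (rule order_trans)
    then show ?thesis using False y unfolding y_def[symmetric] by (simp add: RL_envelope_def)
  qed
qed

text \<open>All integrands of interest, including every simple function, are supported to the left of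
  some \<open>t\<close> and decay exponentially at \<open>-\<infinity>\<close>; for these the transform converges at every point
  and no inequality of Hardy-Littlewood-Sobolev type is needed.\<close>

definition exp_dominated :: "real \<Rightarrow> real \<Rightarrow> real \<Rightarrow> (real \<Rightarrow> real) \<Rightarrow> bool" where
  "exp_dominated c t A f \<longleftrightarrow> f \<in> borel_measurable lebesgue \<and>
     (\<forall>u. \<bar>f u\<bar> \<le> A * (exp (- c * (t - u)) * indicator {..t} u))"

lemma exp_dominated_nonneg:
  assumes "exp_dominated c t A f"
  shows "0 \<le> A"
proof -
  have "\<bar>f t\<bar> \<le> A" using assms unfolding exp_dominated_def by (auto dest: spec[of _ t])
  then show ?thesis by linarith
qed

text \<open>The majorant depends on \<open>f\<close> only through A, c and t. It yields convergence
  of the transform, its pointwise bound, and domination uniformly along a sequence.\<close>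

lemma exp_dominated_kernel_le:
  fixes x :: real
  assumes "exp_dominated c t A f"
  shows "norm (indicator {x..} u *\<^sub>R (f u * (u - x) powr (d - 1)))
    \<le> A * (indicator {x..t} u *\<^sub>R (exp (- c * (t - u)) * (u - x) powr (d - 1)))"
proof -
  have "\<bar>f u\<bar> * (u - x) powr (d - 1) \<le> A * (exp (- c * (t - u)) * indicator {..t} u) * (u - x) powr (d - 1)"
    using assms unfolding exp_dominated_def by (intro mult_right_mono) auto
  then show ?thesis by (auto simp: indicator_def abs_mult)
qed

lemma measurable_exp_dominated_kernel:
  fixes x :: real
  assumes "exp_dominated c t A f"
  shows "(\<lambda>u. indicator {x..} u *\<^sub>R (f u * (u - x) powr (d - 1))) \<in> borel_measurable lebesgue"
proof -
  have f: "f \<in> borel_measurable lebesgue"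
    using assms by (simp add: exp_dominated_def)
  have m: "(\<lambda>u. indicator {x..} u * (u - x) powr (d - 1)) \<in> borel_measurable lebesgue"
    by (intro measurable_completion) measurable
  have "(\<lambda>u. f u * (indicator {x..} u * (u - x) powr (d - 1))) \<in> borel_measurable lebesgue"
    by (rule borel_measurable_times[OF f m])
  then show ?thesis by (simp add: mult_ac)
qed

lemma exp_dominated_RL_integrable:
  assumes "0 < d" "0 < c" "exp_dominated c t A f"
  shows "RL_integrable d f"
  unfolding RL_integrable_def set_integrable_def
proof
  fix x :: real
  show "integrable lebesgue (\<lambda>u. indicator {x..} u *\<^sub>R (f u * (u - x) powr (d - 1)))"
  proof (rule Bochner_Integration.integrable_bound)
    show "integrable lebesgue (\<lambda>u. A * (indicator {x..t} u *\<^sub>R (exp (- c * (t - u)) * (u - x) powr (d - 1))))"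
      using set_integrable_exp_kernel[OF assms(1,2), of x t]
      unfolding set_integrable_def by (intro integrable_mult_right)
    show "AE u in lebesgue. norm (indicator {x..} u *\<^sub>R (f u * (u - x) powr (d - 1)))
      \<le> norm (A * (indicator {x..t} u *\<^sub>R (exp (- c * (t - u)) * (u - x) powr (d - 1))))"
      unfolding real_norm_def[of "A * _"]
      by (intro AE_I2 order_trans[OF exp_dominated_kernel_le[OF assms(3)] abs_ge_self])
  qed (rule measurable_exp_dominated_kernel[OF assms(3)])
qed

lemma exp_dominated_RL_minus_le:
  assumes "0 < d" "d < 1" "0 < c" "exp_dominated c t A f"
  shows "\<bar>RL_minus d f x\<bar> \<le> A * ((1 / d + 2 powr (1 - d) / c + 2 / (c * d)) / Gamma d) * RL_envelope d (t - x)"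
proof -
  have G: "Gamma d > 0" using assms by simp
  have "\<bar>LINT u:{x..}|lebesgue. f u * (u - x) powr (d - 1)\<bar>
    \<le> (\<integral>u. A * (indicator {x..t} u *\<^sub>R (exp (- c * (t - u)) * (u - x) powr (d - 1))) \<partial>lebesgue)"
  proof -
    have "integrable lebesgue (\<lambda>u. A * (indicator {x..t} u *\<^sub>R (exp (- c * (t - u)) * (u - x) powr (d - 1))))"
      using set_integrable_exp_kernel[OF assms(1,3), of x t]
      unfolding set_integrable_def by (intro integrable_mult_right)
    then show ?thesis
      unfolding set_lebesgue_integral_def real_norm_def[symmetric]
      using exp_dominated_RL_integrable[OF assms(1,3,4)]
      by (intro Bochner_Integration.integral_norm_bound_integral exp_dominated_kernel_le[OF assms(4)])
         (auto simp: RL_integrable_def set_integrable_def)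
  qed
  also have "\<dots> = A * (LINT u:{x..t}|lebesgue. exp (- c * (t - u)) * (u - x) powr (d - 1))"
    by (simp add: set_lebesgue_integral_def)
  also have "\<dots> \<le> A * ((1 / d + 2 powr (1 - d) / c + 2 / (c * d)) * RL_envelope d (t - x))"
    by (intro mult_left_mono exp_kernel_bound assms exp_dominated_nonneg[OF assms(4)])
  finally show ?thesis
    using G by (simp add: RL_minus_def abs_mult divide_right_mono)
qed

lemma exp_dominated_RL_minus_Lp:
  assumes "0 < d" "d < 1" "0 < c" "exp_dominated c t A f" "0 < \<alpha>" "\<alpha> * (d - 1) < -1"
  shows "RL_minus d f \<in> Lp_fun lebesgue \<alpha>"
proof -
  have m: "RL_minus d f \<in> borel_measurable borel"
    using assms(4) by (intro borel_measurable_RL_minus) (auto simp: exp_dominated_def)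
  define B where "B = A * ((1 / d + 2 powr (1 - d) / c + 2 / (c * d)) / Gamma d)"
  have "B \<ge> 0"
    unfolding B_def using assms exp_dominated_nonneg[OF assms(4)] by simp
  have "integrable lebesgue (\<lambda>x. \<bar>RL_minus d f x\<bar> powr \<alpha>)"
  proof (rule Bochner_Integration.integrable_bound)
    show "integrable lebesgue (\<lambda>x. B powr \<alpha> * RL_envelope d (t - x) powr \<alpha>)"
      using assms by (intro integrable_mult_right integrable_RL_envelope_powr)
    show "AE x in lebesgue. norm (\<bar>RL_minus d f x\<bar> powr \<alpha>) \<le> norm (B powr \<alpha> * RL_envelope d (t - x) powr \<alpha>)"
      using exp_dominated_RL_minus_le[OF assms(1-4), folded B_def] \<open>B \<ge> 0\<close> assms(5)
      by (intro AE_I2) (auto simp del: times_divide_eq_right times_divide_eq_left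
          simp: powr_mult[symmetric] RL_envelope_nonneg intro!: powr_mono2)
    show "(\<lambda>x. \<bar>RL_minus d f x\<bar> powr \<alpha>) \<in> borel_measurable lebesgue"
      using m by (intro measurable_completion) simp
  qed
  moreover have "RL_minus d f \<in> borel_measurable lebesgue"
    using m by (intro measurable_completion) simp
  ultimately show ?thesis by (simp add: Lp_fun_def)
qed

section \<open>Approximation by simple functions\<close>

lemma exp_dominated_Lp:
  assumes "0 < c" "0 < q" "exp_dominated c t A f"
  shows "f \<in> Lp_fun lebesgue q"
proof -
  have f[measurable]: "f \<in> borel_measurable lebesgue" using assms by (simp add: exp_dominated_def)
  have "(\<lambda>y. exp (- (c * q) * y)) absolutely_integrable_on {0..}"
    using has_integral_exp_minus_to_infinity[of "c * q" 0] assms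
    by (intro nonnegative_absolutely_integrable_1) (auto simp: integrable_on_def)
  then have "integrable lborel (\<lambda>y. indicator {0..} y *\<^sub>R exp (- (c * q) * y))"
    unfolding set_integrable_def by (rule integrable_lebesgue_imp_lborel) measurable
  then have "integrable lborel (\<lambda>u. indicator {0..} (t + - 1 * u) *\<^sub>R exp (- (c * q) * (t + - 1 * u)))"
    by (rule lborel_integrable_real_affine) simp
  then have "integrable lebesgue (\<lambda>u. indicator {0..} (t + - 1 * u) *\<^sub>R exp (- (c * q) * (t + - 1 * u)))"
    by (subst integrable_completion) simp_all
  then have "integrable lebesgue (\<lambda>u. A powr q * (indicator {0..} (t + - 1 * u) *\<^sub>R exp (- (c * q) * (t + - 1 * u))))"
    by (rule integrable_mult_right)
  then have "integrable lebesgue (\<lambda>u. \<bar>f u\<bar> powr q)"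
  proof (rule Bochner_Integration.integrable_bound)
    show "AE u in lebesgue. norm (\<bar>f u\<bar> powr q)
      \<le> norm (A powr q * (indicator {0..} (t + - 1 * u) *\<^sub>R exp (- (c * q) * (t + - 1 * u))))"
    proof (rule AE_I2)
      fix u
      have "\<bar>f u\<bar> powr q \<le> (A * (exp (- c * (t - u)) * indicator {..t} u)) powr q"
        using assms by (intro powr_mono2) (auto simp: exp_dominated_def)
      also have "\<dots> = A powr q * (indicator {0..} (t + - 1 * u) *\<^sub>R exp (- (c * q) * (t + - 1 * u)))"
        using exp_dominated_nonneg[OF assms(3)]
        by (auto simp: indicator_def powr_mult exp_powr_real algebra_simps)
      finally show "norm (\<bar>f u\<bar> powr q)
        \<le> norm (A powr q * (indicator {0..} (t + - 1 * u) *\<^sub>R exp (- (c * q) * (t + - 1 * u))))"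
        by simp
    qed
  qed measurable
  with f show ?thesis by (simp add: Lp_fun_def)
qed

text \<open>On (s,t] the exponential is at least exp (- c * (t - s)), and the constant is the
  reciprocal of that value.\<close>

lemma exp_dominated_indicator:
  assumes "0 < c"
  shows "exp_dominated c t (exp (c * (t - s))) (indicator {s<..t})"
  unfolding exp_dominated_def using assms
  by (auto simp: indicator_def exp_add[symmetric] algebra_simps intro!: measurable_completion)

lemma RL_integrable_indicator:
  assumes "0 < d"
  shows "RL_integrable d (indicator {s<..t})"
  using exp_dominated_RL_integrable[OF assms zero_less_one exp_dominated_indicator] by simp

lemma simple_fun_eq:
  "simple_fun (n, a, \<tau>) = (\<lambda>x. \<Sum>i\<in>{1..<n}. a i * indicator {\<tau> i<..\<tau> (Suc i)} x)"
  by (simp only: simple_fun_def prod.case)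

lemma RL_integrable_simple_fun:
  assumes "0 < d"
  shows "RL_integrable d (simple_fun \<phi>)"
proof (cases \<phi>)
  case (fields n a \<tau>)
  show ?thesis unfolding fields simple_fun_eq
    by (intro RL_integrable_sum RL_integrable_cmult RL_integrable_indicator assms)
qed

lemma RL_minus_simple_fun:
  assumes "0 < d"
  shows "RL_minus d (simple_fun (n, a, \<tau>)) x
    = (\<Sum>i\<in>{1..<n}. a i * RL_minus d (indicator {\<tau> i<..\<tau> (Suc i)}) x)"
  unfolding simple_fun_eq RL_minus_cmult[symmetric]
  by (intro RL_minus_sum RL_integrable_cmult RL_integrable_indicator assms)

text \<open>By weak monotonicity of the nodes, every other interval ends at or before \<tau> i or
  starts at or after \<tau> (Suc i), so its indicator vanishes at \<open>x\<close>.\<close>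

lemma simple_fun_eqI:
  assumes "strict_mono_on {1..n} \<tau>" "i \<in> {1..<n}" "x \<in> {\<tau> i<..\<tau> (Suc i)}"
  shows "simple_fun (n, a, \<tau>) x = a i"
proof -
  have le: "\<tau> j \<le> \<tau> k" if "j \<in> {1..n}" "k \<in> {1..n}" "j \<le> k" for j k
    using strict_mono_onD[OF assms(1), of j k] that by (cases "j = k") auto
  have "a j * indicator {\<tau> j<..\<tau> (Suc j)} x = (if j = i then a i else 0)" if "j \<in> {1..<n}" for j
  proof -
    consider "j = i" | "Suc j \<le> i" | "Suc i \<le> j" by linarith
    then show ?thesis
    proof cases
      case 2
      then have "\<tau> (Suc j) \<le> \<tau> i" using that assms by (intro le) auto
      then show ?thesis using assms 2 by (auto simp: indicator_def)
    next
      case 3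
      then have "\<tau> (Suc i) \<le> \<tau> j" using that assms by (intro le) auto
      then show ?thesis using assms 3 by (auto simp: indicator_def)
    qed (use assms in auto)
  qed
  then have "simple_fun (n, a, \<tau>) x = (\<Sum>j\<in>{1..<n}. if j = i then a i else 0)"
    unfolding simple_fun_eq by (intro sum.cong refl)
  also have "\<dots> = a i" using assms by (simp add: sum.delta)
  finally show ?thesis .
qed

lemma simple_fun_eq_0:
  assumes "strict_mono_on {1..n} \<tau>" "x \<notin> {\<tau> 1<..\<tau> n}"
  shows "simple_fun (n, a, \<tau>) x = 0"
proof -
  have le: "\<tau> j \<le> \<tau> k" if "j \<in> {1..n}" "k \<in> {1..n}" "j \<le> k" for j k
    using strict_mono_onD[OF assms(1), of j k] that by (cases "j = k") auto
  have "a j * indicator {\<tau> j<..\<tau> (Suc j)} x = 0" if "j \<in> {1..<n}" for j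
  proof -
    have "\<tau> 1 \<le> \<tau> j" "\<tau> (Suc j) \<le> \<tau> n" using that by (auto intro!: le)
    then show ?thesis using assms(2) by (auto simp: indicator_def)
  qed
  then show ?thesis unfolding simple_fun_eq by (intro sum.neutral) simp
qed

text \<open>Uniform continuity on the compact interval supplies \<delta>. The interval is cut into N
  equal cells shorter than \<delta>, and each cell carries the value of \<open>h\<close> at its
  right endpoint.\<close>

lemma continuous_step_approximation:
  fixes h :: "real \<Rightarrow> real"
  assumes h: "continuous_on {a..b} h" and ab: "a < b" and e: "0 < e"
  obtains \<phi> where "\<phi> \<in> simple_data"
    "\<And>x. x \<in> {a<..b} \<Longrightarrow> \<bar>simple_fun \<phi> x - h x\<bar> \<le> e"
    "\<And>x. x \<notin> {a<..b} \<Longrightarrow> simple_fun \<phi> x = 0"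
proof -
  obtain \<delta> where \<delta>: "\<delta> > 0"
    "\<And>x y. x \<in> {a..b} \<Longrightarrow> y \<in> {a..b} \<Longrightarrow> dist y x < \<delta> \<Longrightarrow> dist (h y) (h x) < e"
    using compact_uniformly_continuous[OF h compact_Icc] e unfolding uniformly_continuous_on_def by metis
  obtain N0 :: nat where N0: "(b - a) / \<delta> < real N0" using reals_Archimedean2 by blast
  define N where "N = Suc N0"
  have "(b - a) / \<delta> < real N" using N0 by (simp add: N_def)
  then have N: "N \<ge> 1" "(b - a) / real N < \<delta>" using \<delta>(1) by (simp_all add: N_def field_simps)
  define w where "w = (b - a) / real N"
  have w: "w > 0" "w < \<delta>" using ab N by (auto simp: w_def)
  \<comment> \<open>Nodes are numbered from 1, as in \<open>simple_data\<close>, so the N cells use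
    the nodes 1 to N + 1.\<close>
  define \<tau> where "\<tau> i = a + w * (real i - 1)" for i
  have \<tau>1: "\<tau> 1 = a" and \<tau>N: "\<tau> (Suc N) = b" using N by (auto simp: \<tau>_def w_def)
  have sm: "strict_mono_on {1..Suc N} \<tau>"
    using w by (auto simp: strict_mono_on_def \<tau>_def)
  define \<phi> where "\<phi> = (Suc N, \<lambda>i. h (\<tau> (Suc i)), \<tau>)"
  show thesis
  proof
    show "\<phi> \<in> simple_data" using N sm by (simp add: \<phi>_def simple_data_def)
    show "simple_fun \<phi> x = 0" if "x \<notin> {a<..b}" for x
      unfolding \<phi>_def by (rule simple_fun_eq_0[OF sm]) (use that in \<open>simp only: \<tau>1 \<tau>N not_False_eq_True\<close>)
    show "\<bar>simple_fun \<phi> x - h x\<bar> \<le> e" if x: "x \<in> {a<..b}" for x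
    proof -
      define z where "z = (x - a) / w"
      have xz: "x = a + w * z" using w by (simp add: z_def)
      have "z > 0" using x w by (simp add: z_def)
      have "w * real N = b - a" using N by (simp add: w_def)
      moreover have "x - a \<le> b - a" using x by simp
      ultimately have "w * z \<le> w * real N" by (simp add: xz)
      then have "z \<le> real N" using w by simp
      \<comment> \<open>\<open>z\<close> is the distance of \<open>x\<close> from \<open>a\<close>
        in cell widths. Rounding up matches cells that are open on the left: a node belongs to the
        cell that ends there.\<close>
      define i where "i = nat \<lceil>z\<rceil>"
      have i: "real i - 1 < z" "z \<le> real i" "1 \<le> i"
        using \<open>z > 0\<close> unfolding i_def by linarith+
      have "i \<le> N" using \<open>z \<le> real N\<close> unfolding i_def by linarith
      have "w * (real i - 1) < w * z" "w * z \<le> w * real i" using i w by auto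
      then have xi: "x \<in> {\<tau> i<..\<tau> (Suc i)}"
        by (auto simp: \<tau>_def xz)
      have "simple_fun \<phi> x = h (\<tau> (Suc i))"
        unfolding \<phi>_def by (rule simple_fun_eqI[OF sm _ xi]) (use i \<open>i \<le> N\<close> in auto)
      moreover have "\<tau> (Suc i) \<in> {a..b}"
      proof -
        have "w * real i \<le> w * real N" using \<open>i \<le> N\<close> w by simp
        then show ?thesis using x xi \<tau>N by (auto simp: \<tau>_def)
      qed
      moreover have "dist (\<tau> (Suc i)) x < \<delta>"
        using xi w by (auto simp: \<tau>_def dist_real_def algebra_simps)
      ultimately show ?thesis using \<delta>(2)[of x "\<tau> (Suc i)"] x by (auto simp: dist_real_def)
    qed
  qed
qed

lemma borel_measurable_simple_fun: "simple_fun \<phi> \<in> borel_measurable lebesgue"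
proof (cases \<phi>)
  case (fields n a \<tau>)
  show ?thesis unfolding fields simple_fun_eq by (intro measurable_completion) measurable
qed

text \<open>Continuous functions converging to \<open>f\<close> almost everywhere are clamped to the
  envelope and replaced by step functions on windows that grow to the left. A single envelope for
  the whole sequence is what dominated convergence will need.\<close>

lemma exp_dominated_step_approximation:
  assumes c: "0 < c" and f: "exp_dominated c t A f"
  obtains \<phi> where "\<And>k. \<phi> k \<in> simple_data"
    "\<And>k. exp_dominated c t (A + 1) (simple_fun (\<phi> k))"
    "AE x in lebesgue. (\<lambda>k. simple_fun (\<phi> k) x) \<longlonglongrightarrow> f x"
proof -
  have A: "0 \<le> A" by (rule exp_dominated_nonneg[OF f])
  define D where "D u = A * exp (- c * (t - u))" for u
  have D0: "D u \<ge> 0" for u using A by (simp add: D_def)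
  have fD: "\<bar>f u\<bar> \<le> D u" "u > t \<Longrightarrow> f u = 0" for u
  proof -
    have fu: "\<bar>f u\<bar> \<le> D u * indicator {..t} u"
      using f by (simp add: exp_dominated_def D_def mult.assoc)
    show "\<bar>f u\<bar> \<le> D u" using fu D0[of u] by (cases "u \<le> t") auto
    show "f u = 0" if "u > t" using fu that by simp
  qed
  have "f measurable_on UNIV"
    using f by (intro lebesgue_measurable_imp_measurable_on_real) (auto simp: exp_dominated_def)
  then obtain N h where N: "negligible N" and hc: "\<And>n::nat. continuous_on UNIV (h n)"
    and hlim: "\<And>x. x \<notin> N \<Longrightarrow> (\<lambda>n. h n x) \<longlonglongrightarrow> f x"
    unfolding measurable_on_def by auto
  \<comment> \<open>Clamping to [-D, D] is continuous and fixes the limit, since |f| \<le>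
    D.\<close>
  define H where "H n u = max (- D u) (min (D u) (h n u))" for n u
  have Hc: "continuous_on S (H n)" for n S
    unfolding H_def D_def
    by (intro continuous_intros continuous_on_subset[OF hc]) auto
  have HD: "\<bar>H n u\<bar> \<le> D u" for n u using D0[of u] unfolding H_def by auto
  have Hlim: "(\<lambda>n. H n x) \<longlonglongrightarrow> f x" if "x \<notin> N" for x
  proof -
    have "(\<lambda>n. H n x) \<longlonglongrightarrow> max (- D x) (min (D x) (f x))"
      unfolding H_def by (intro tendsto_intros hlim that)
    also have "max (- D x) (min (D x) (f x)) = f x" using fD(1)[of x] by auto
    finally show ?thesis .
  qed
  \<comment> \<open>The tolerance is the value of the exponential at the left end of the window (t -
    (k + 1), t]. Inside it is at most exp (- c * (t - u)), so the error is absorbed by raising A to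
    A + 1.\<close>
  define \<epsilon> where "\<epsilon> k = exp (- c * real (Suc k))" for k
  have "\<exists>\<phi>. \<phi> \<in> simple_data \<and> (\<forall>x\<in>{t - real (Suc k)<..t}. \<bar>simple_fun \<phi> x - H k x\<bar> \<le> \<epsilon> k)
      \<and> (\<forall>x. x \<notin> {t - real (Suc k)<..t} \<longrightarrow> simple_fun \<phi> x = 0)" for k
  proof -
    have "t - real (Suc k) < t" "0 < \<epsilon> k" by (simp_all add: \<epsilon>_def)
    from continuous_step_approximation[OF Hc this] show ?thesis by metis
  qed
  then obtain \<phi> where \<phi>: "\<And>k. \<phi> k \<in> simple_data"
    and near: "\<And>k x. x \<in> {t - real (Suc k)<..t} \<Longrightarrow> \<bar>simple_fun (\<phi> k) x - H k x\<bar> \<le> \<epsilon> k"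
    and out: "\<And>k x. x \<notin> {t - real (Suc k)<..t} \<Longrightarrow> simple_fun (\<phi> k) x = 0"
    by metis
  show thesis
  proof
    show "\<phi> k \<in> simple_data" for k by (rule \<phi>)
    show "exp_dominated c t (A + 1) (simple_fun (\<phi> k))" for k
      unfolding exp_dominated_def
    proof (intro conjI allI borel_measurable_simple_fun)
      fix u
      show "\<bar>simple_fun (\<phi> k) u\<bar> \<le> (A + 1) * (exp (- c * (t - u)) * indicator {..t} u)"
      proof (cases "u \<in> {t - real (Suc k)<..t}")
        case True
        then have "c * (t - u) \<le> c * real (Suc k)" using c by (intro mult_left_mono) auto
        then have "\<epsilon> k \<le> exp (- c * (t - u))" by (simp add: \<epsilon>_def)
        with near[OF True] HD[of k u] have "\<bar>simple_fun (\<phi> k) u\<bar> \<le> D u + exp (- c * (t - u))"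
          by linarith
        with True show ?thesis by (simp add: D_def algebra_simps)
      qed (use out A in simp)
    qed
    have "AE x in lebesgue. x \<notin> N"
      using N by (simp add: AE_not_in negligible_iff_null_sets)
    then show "AE x in lebesgue. (\<lambda>k. simple_fun (\<phi> k) x) \<longlonglongrightarrow> f x"
    proof eventually_elim
      fix x assume x: "x \<notin> N"
      show "(\<lambda>k. simple_fun (\<phi> k) x) \<longlonglongrightarrow> f x"
      proof (cases "x \<le> t")
        case False
        then have "simple_fun (\<phi> k) x = 0" for k using out by auto
        then show ?thesis using fD(2)[of x] False by simp
      next
        case True
        \<comment> \<open>From index \<open>k0\<close> on the window contains \<open>x\<close>, and
          the tolerance governs the error there.\<close>
        obtain k0 :: nat where k0: "t - x < real k0" using reals_Archimedean2 by blast
        have "(\<lambda>k. simple_fun (\<phi> k) x - H k x) \<longlonglongrightarrow> 0"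
        proof (rule Lim_null_comparison)
          show "\<forall>\<^sub>F k in sequentially. norm (simple_fun (\<phi> k) x - H k x) \<le> \<epsilon> k"
            using eventually_ge_at_top[of k0]
          proof eventually_elim
            case (elim k)
            then have "real k0 \<le> real k" by simp
            then show ?case using near[of x k] True k0 by auto
          qed
          show "\<epsilon> \<longlonglongrightarrow> 0"
            unfolding \<epsilon>_def using c by real_asymp
        qed
        from tendsto_add[OF this Hlim[OF x]] show ?thesis by simp
      qed
    qed
  qed
qed

text \<open>Dominated convergence is used twice: for fixed \<open>x\<close> under the kernel
  majorant, which gives pointwise convergence of the transforms, and then in \<open>x\<close> under
  a multiple of the \<alpha>-th power of the envelope.\<close>

lemma RL_minus_dominated_convergence:
  assumes d: "0 < d" "d < 1" and c: "0 < c" and \<alpha>: "0 < \<alpha>" "\<alpha> * (d - 1) < -1"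
    and h: "\<And>k. exp_dominated c t B (h k)"
    and lim: "AE x in lebesgue. (\<lambda>k. h k x) \<longlonglongrightarrow> 0"
  shows "(\<lambda>k. \<integral>x. \<bar>RL_minus d (h k) x\<bar> powr \<alpha> \<partial>lebesgue) \<longlonglongrightarrow> 0"
proof -
  have pt: "(\<lambda>k. RL_minus d (h k) x) \<longlonglongrightarrow> 0" for x
  proof -
    have "(\<lambda>k. \<integral>u. indicator {x..} u *\<^sub>R (h k u * (u - x) powr (d - 1)) \<partial>lebesgue) \<longlonglongrightarrow> (\<integral>u. 0 \<partial>(lebesgue :: real measure))"
    proof (rule integral_dominated_convergence)
      show "(\<lambda>u. indicator {x..} u *\<^sub>R (h k u * (u - x) powr (d - 1))) \<in> borel_measurable lebesgue" for k
        by (rule measurable_exp_dominated_kernel[OF h])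
      show "integrable lebesgue (\<lambda>u. B * (indicator {x..t} u *\<^sub>R (exp (- c * (t - u)) * (u - x) powr (d - 1))))"
        using set_integrable_exp_kernel[OF d(1) c, of x t]
        unfolding set_integrable_def by (intro integrable_mult_right)
      show "AE u in lebesgue. norm (indicator {x..} u *\<^sub>R (h k u * (u - x) powr (d - 1)))
        \<le> B * (indicator {x..t} u *\<^sub>R (exp (- c * (t - u)) * (u - x) powr (d - 1)))" for k
        by (intro AE_I2 exp_dominated_kernel_le[OF h])
      show "AE u in lebesgue. (\<lambda>k. indicator {x..} u *\<^sub>R (h k u * (u - x) powr (d - 1))) \<longlonglongrightarrow> 0"
        using lim by eventually_elim (auto intro!: tendsto_mult_right_zero tendsto_mult_left_zero)
    qed simp
    then have "(\<lambda>k. 1 / Gamma d * (LINT u:{x..}|lebesgue. h k u * (u - x) powr (d - 1))) \<longlonglongrightarrow> 0"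
      unfolding set_lebesgue_integral_def by (intro tendsto_mult_right_zero) simp
    then show ?thesis by (simp add: RL_minus_def)
  qed
  define K where "K = B * ((1 / d + 2 powr (1 - d) / c + 2 / (c * d)) / Gamma d)"
  have K: "K \<ge> 0"
    unfolding K_def using d c exp_dominated_nonneg[OF h] by simp
  have "(\<lambda>k. \<integral>x. \<bar>RL_minus d (h k) x\<bar> powr \<alpha> \<partial>lebesgue) \<longlonglongrightarrow> (\<integral>x. 0 \<partial>(lebesgue :: real measure))"
  proof (rule integral_dominated_convergence)
    show "(\<lambda>x. \<bar>RL_minus d (h k) x\<bar> powr \<alpha>) \<in> borel_measurable lebesgue" for k
      using borel_measurable_RL_minus[of "h k" d] h[of k]
      by (intro measurable_completion) (simp add: exp_dominated_def)
    show "integrable lebesgue (\<lambda>x. K powr \<alpha> * RL_envelope d (t - x) powr \<alpha>)"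
      using \<alpha> by (intro integrable_mult_right integrable_RL_envelope_powr)
    show "AE x in lebesgue. norm (\<bar>RL_minus d (h k) x\<bar> powr \<alpha>) \<le> K powr \<alpha> * RL_envelope d (t - x) powr \<alpha>" for k
      using exp_dominated_RL_minus_le[OF d c h, folded K_def] K \<alpha>
      by (intro AE_I2) (auto simp: powr_mult[symmetric] RL_envelope_nonneg intro!: powr_mono2)
    show "AE x in lebesgue. (\<lambda>k. \<bar>RL_minus d (h k) x\<bar> powr \<alpha>) \<longlonglongrightarrow> 0"
      using pt \<alpha> by (intro AE_I2 tendsto_zero_powrI[where b=\<alpha>] tendsto_rabs_zero) auto
  qed simp
  then show ?thesis by simp
qed

section \<open>Stable integrals\<close>

text \<open>A sum of two nonnegative terms is at most twice the larger one. Its q-th power is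
  therefore bounded by a sum of q-th powers for every q > 0, without convexity.\<close>

lemma Lp_fun_lincomb:
  assumes q: "0 < q" and f: "f \<in> Lp_fun M q" and h: "h \<in> Lp_fun M q"
  shows "(\<lambda>x. a * f x + b * h x) \<in> Lp_fun M q"
proof -
  have [measurable]: "f \<in> borel_measurable M" "h \<in> borel_measurable M"
    and i: "integrable M (\<lambda>x. \<bar>f x\<bar> powr q)" "integrable M (\<lambda>x. \<bar>h x\<bar> powr q)"
    using f h by (auto simp: Lp_fun_def)
  have "integrable M (\<lambda>x. \<bar>a * f x + b * h x\<bar> powr q)"
  proof (rule Bochner_Integration.integrable_bound)
    show "integrable M (\<lambda>x. (2 * \<bar>a\<bar>) powr q * \<bar>f x\<bar> powr q + (2 * \<bar>b\<bar>) powr q * \<bar>h x\<bar> powr q)"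
      using i by simp
    show "AE x in M. norm (\<bar>a * f x + b * h x\<bar> powr q)
      \<le> norm ((2 * \<bar>a\<bar>) powr q * \<bar>f x\<bar> powr q + (2 * \<bar>b\<bar>) powr q * \<bar>h x\<bar> powr q)"
    proof (rule AE_I2)
      fix x
      define m where "m = max (2 * \<bar>a\<bar> * \<bar>f x\<bar>) (2 * \<bar>b\<bar> * \<bar>h x\<bar>)"
      have "\<bar>a * f x + b * h x\<bar> \<le> \<bar>a\<bar> * \<bar>f x\<bar> + \<bar>b\<bar> * \<bar>h x\<bar>"
        using abs_triangle_ineq[of "a * f x" "b * h x"] by (simp add: abs_mult)
      also have "\<dots> \<le> m" by (simp add: m_def)
      finally have "\<bar>a * f x + b * h x\<bar> powr q \<le> m powr q"
        using q by (intro powr_mono2) auto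
      also have "\<dots> \<le> (2 * \<bar>a\<bar> * \<bar>f x\<bar>) powr q + (2 * \<bar>b\<bar> * \<bar>h x\<bar>) powr q"
        by (simp add: m_def max_def)
      finally show "norm (\<bar>a * f x + b * h x\<bar> powr q)
        \<le> norm ((2 * \<bar>a\<bar>) powr q * \<bar>f x\<bar> powr q + (2 * \<bar>b\<bar>) powr q * \<bar>h x\<bar> powr q)"
        by (simp add: powr_mult)
    qed
  qed measurable
  then show ?thesis by (simp add: Lp_fun_def)
qed

lemma Lp_fun_cong_AE:
  assumes "X \<in> borel_measurable M" "Y \<in> Lp_fun M q" "AE \<omega> in M. X \<omega> = Y \<omega>"
  shows "X \<in> Lp_fun M q"
proof -
  have "integrable M (\<lambda>\<omega>. \<bar>X \<omega>\<bar> powr q) \<longleftrightarrow> integrable M (\<lambda>\<omega>. \<bar>Y \<omega>\<bar> powr q)"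
    using assms by (intro integrable_cong_AE) (auto simp: Lp_fun_def)
  then show ?thesis using assms by (simp add: Lp_fun_def)
qed

locale stable_noise = prob_space P
  for P :: "'w measure" and \<alpha> :: real and L :: "real \<Rightarrow> 'w \<Rightarrow> real" and SI :: "(real \<Rightarrow> real) \<Rightarrow> 'w \<Rightarrow> real" +
  assumes alpha_pos: "0 < \<alpha>"
    and process: "SaS_process P \<alpha> L"
    and SI: "stable_integral P \<alpha> L SI"
begin

lemma L_measurable [measurable]: "L t \<in> borel_measurable P"
  using process by (simp add: SaS_process_def)

lemma SI_measurable: "f \<in> Lp_fun lebesgue \<alpha> \<Longrightarrow> SI f \<in> borel_measurable P"
  using SI by (simp add: stable_integral_def)

lemma SI_lincomb:
  "f \<in> Lp_fun lebesgue \<alpha> \<Longrightarrow> h \<in> Lp_fun lebesgue \<alpha> \<Longrightarrow>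
    AE \<omega> in P. SI (\<lambda>x. a * f x + b * h x) \<omega> = a * SI f \<omega> + b * SI h \<omega>"
  using SI by (simp add: stable_integral_def)

text \<open>Membership and linearity are proved together, because each use of linearity in the
  induction requires the partial sum to lie in L^\<alpha>.\<close>

lemma SI_sum:
  assumes "finite I" "\<And>i. i \<in> I \<Longrightarrow> f i \<in> Lp_fun lebesgue \<alpha>"
  shows "(\<lambda>x. \<Sum>i\<in>I. a i * f i x) \<in> Lp_fun lebesgue \<alpha> \<and>
    (AE \<omega> in P. SI (\<lambda>x. \<Sum>i\<in>I. a i * f i x) \<omega> = (\<Sum>i\<in>I. a i * SI (f i) \<omega>))"
  using assms
proof (induction rule: finite_induct)
  case empty
  \<comment> \<open>Linearity with both coefficients 0 shows that the integral of the zero function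
    is 0 almost surely.\<close>
  have z: "(\<lambda>_. 0) \<in> Lp_fun lebesgue \<alpha>" using alpha_pos by (simp add: Lp_fun_def)
  from SI_lincomb[OF z z, of 0 0] z show ?case by simp
next
  case (insert j I)
  then have IH: "(\<lambda>x. \<Sum>i\<in>I. a i * f i x) \<in> Lp_fun lebesgue \<alpha>"
    "AE \<omega> in P. SI (\<lambda>x. \<Sum>i\<in>I. a i * f i x) \<omega> = (\<Sum>i\<in>I. a i * SI (f i) \<omega>)"
    and j: "f j \<in> Lp_fun lebesgue \<alpha>" by auto
  have eq: "(\<lambda>x. \<Sum>i\<in>insert j I. a i * f i x) = (\<lambda>x. a j * f j x + 1 * (\<Sum>i\<in>I. a i * f i x))"
    using insert.hyps by simp
  have "AE \<omega> in P. SI (\<lambda>x. \<Sum>i\<in>insert j I. a i * f i x) \<omega> = (\<Sum>i\<in>insert j I. a i * SI (f i) \<omega>)"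
    unfolding eq using SI_lincomb[OF j IH(1), of "a j" 1] IH(2)
    by eventually_elim (use insert.hyps in simp)
  moreover have "(\<lambda>x. \<Sum>i\<in>insert j I. a i * f i x) \<in> Lp_fun lebesgue \<alpha>"
    unfolding eq by (rule Lp_fun_lincomb[OF alpha_pos j IH(1)])
  ultimately show ?case by blast
qed

lemma char_L1: "char (distr P borel (L 1)) \<theta> = complex_of_real (exp (- (\<bar>\<theta>\<bar> powr \<alpha>)))"
proof -
  have "distr P borel (L 1) = distr P borel (\<lambda>\<omega>. L 1 \<omega> - L 0 \<omega>)"
    using process by (intro distr_cong_AE) (auto simp: SaS_process_def)
  moreover have "char (distr P borel (\<lambda>\<omega>. L 1 \<omega> - L 0 \<omega>)) \<theta>
      = complex_of_real (exp (- (\<bar>\<theta>\<bar> powr \<alpha> * (1 - 0))))"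
    using process zero_less_one unfolding SaS_process_def by blast
  ultimately show ?thesis by simp
qed

text \<open>Here \<sigma> is the L^\<alpha> norm of \<open>f\<close>, and both characteristic
  functions equal exp (- |\<theta>|^\<alpha> * \<sigma>^\<alpha>). Levy's uniqueness theorem
  concludes.\<close>

lemma distr_SI:
  assumes f: "f \<in> Lp_fun lebesgue \<alpha>"
  defines "\<sigma> \<equiv> (\<integral>x. \<bar>f x\<bar> powr \<alpha> \<partial>lebesgue) powr (1 / \<alpha>)"
  shows "distr P borel (SI f) = distr P borel (\<lambda>\<omega>. \<sigma> * L 1 \<omega>)"
proof (rule Levy_uniqueness)
  note SI_measurable[OF f, measurable]
  show "real_distribution (distr P borel (SI f))" "real_distribution (distr P borel (\<lambda>\<omega>. \<sigma> * L 1 \<omega>))"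
    by (auto intro!: real_distribution_distr)
  show "char (distr P borel (SI f)) = char (distr P borel (\<lambda>\<omega>. \<sigma> * L 1 \<omega>))"
  proof
    fix \<theta>
    have \<sigma>: "\<sigma> \<ge> 0" "\<sigma> powr \<alpha> = (\<integral>x. \<bar>f x\<bar> powr \<alpha> \<partial>lebesgue)"
      using alpha_pos by (auto simp: \<sigma>_def powr_powr)
    have "char (distr P borel (\<lambda>\<omega>. \<sigma> * L 1 \<omega>)) \<theta> = char (distr P borel (L 1)) (\<theta> * \<sigma>)"
      unfolding char_def by (subst (1 2) integral_distr) (auto simp: mult.assoc)
    also have "\<dots> = complex_of_real (exp (- (\<bar>\<theta>\<bar> powr \<alpha> * \<sigma> powr \<alpha>)))"
      using \<sigma> by (simp add: char_L1 abs_mult powr_mult)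
    also have "\<dots> = char (distr P borel (SI f)) \<theta>"
      using SI f unfolding \<sigma> stable_integral_def by simp
    finally show "char (distr P borel (SI f)) \<theta> = char (distr P borel (\<lambda>\<omega>. \<sigma> * L 1 \<omega>)) \<theta>" by simp
  qed
qed

text \<open>Moments depend only on the law, so they reduce to those of \<sigma> * L 1, which are
  finite below order \<alpha>. Applied to a transform, the formula turns p-th means into powers of
  \<open>frac_norm\<close>.\<close>

lemma SI_moment:
  assumes p: "0 < p" "p < \<alpha>" and f: "f \<in> Lp_fun lebesgue \<alpha>"
  shows "SI f \<in> Lp_fun P p"
    and "(\<integral>\<omega>. \<bar>SI f \<omega>\<bar> powr p \<partial>P)
      = (\<integral>\<omega>. \<bar>L 1 \<omega>\<bar> powr p \<partial>P) * ((\<integral>x. \<bar>f x\<bar> powr \<alpha> \<partial>lebesgue) powr (1 / \<alpha>)) powr p"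
proof -
  note SI_measurable[OF f, measurable]
  define \<sigma> where "\<sigma> = (\<integral>x. \<bar>f x\<bar> powr \<alpha> \<partial>lebesgue) powr (1 / \<alpha>)"
  have "integrable (distr P borel (L 1)) (\<lambda>x. \<bar>x\<bar> powr p)"
    using p by (intro integrable_abs_powr_of_stable[OF _ _ _ char_L1]) auto
  then have i1: "integrable P (\<lambda>\<omega>. \<bar>L 1 \<omega>\<bar> powr p)"
    by (subst (asm) integrable_distr_eq) auto
  have eq: "\<bar>\<sigma> * L 1 \<omega>\<bar> powr p = \<sigma> powr p * \<bar>L 1 \<omega>\<bar> powr p" for \<omega>
    by (simp add: \<sigma>_def abs_mult powr_mult)
  have i2: "integrable P (\<lambda>\<omega>. \<bar>\<sigma> * L 1 \<omega>\<bar> powr p)"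
    unfolding eq using i1 by (rule integrable_mult_right)
  note d = distr_SI[OF f, folded \<sigma>_def]
  have "integrable (distr P borel (\<lambda>\<omega>. \<sigma> * L 1 \<omega>)) (\<lambda>x. \<bar>x\<bar> powr p)"
    using i2 by (subst integrable_distr_eq) auto
  then have "integrable (distr P borel (SI f)) (\<lambda>x. \<bar>x\<bar> powr p)"
    by (simp only: d)
  then have "integrable P (\<lambda>\<omega>. \<bar>SI f \<omega>\<bar> powr p)"
    by (subst (asm) integrable_distr_eq) auto
  then show "SI f \<in> Lp_fun P p" by (simp add: Lp_fun_def)
  have "(\<integral>\<omega>. \<bar>SI f \<omega>\<bar> powr p \<partial>P) = (\<integral>x. \<bar>x\<bar> powr p \<partial>distr P borel (SI f))"
    by (subst integral_distr) auto
  also have "\<dots> = (\<integral>\<omega>. \<bar>\<sigma> * L 1 \<omega>\<bar> powr p \<partial>P)"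
    unfolding d by (subst integral_distr) auto
  also have "\<dots> = (\<integral>\<omega>. \<bar>L 1 \<omega>\<bar> powr p \<partial>P) * \<sigma> powr p"
    unfolding eq by simp
  finally show "(\<integral>\<omega>. \<bar>SI f \<omega>\<bar> powr p \<partial>P)
      = (\<integral>\<omega>. \<bar>L 1 \<omega>\<bar> powr p \<partial>P) * ((\<integral>x. \<bar>f x\<bar> powr \<alpha> \<partial>lebesgue) powr (1 / \<alpha>)) powr p"
    by (simp add: \<sigma>_def)
qed

end

section \<open>Integration with respect to linear fractional stable motion\<close>

locale fractional_stable_noise = stable_noise +
  fixes d :: real
  assumes d_pos: "0 < d" and d_lt: "d < 1 - 1 / \<alpha>"
begin

lemma d_lt_1: "d < 1"
  using d_lt alpha_pos by (smt (verit) divide_pos_pos)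

lemma alpha_d: "\<alpha> * (d - 1) < - 1"
  using d_lt alpha_pos by (simp add: field_simps)

lemma RL_minus_Lp:
  "0 < c \<Longrightarrow> exp_dominated c t A f \<Longrightarrow> RL_minus d f \<in> Lp_fun lebesgue \<alpha>"
  using exp_dominated_RL_minus_Lp d_pos d_lt_1 alpha_pos alpha_d by blast

lemma RL_minus_indicator_Lp: "RL_minus d (indicator {s<..t}) \<in> Lp_fun lebesgue \<alpha>"
  using RL_minus_Lp[OF zero_less_one exp_dominated_indicator[OF zero_less_one]] .

text \<open>Up to the factor Gamma (d + 1), and a sign when t < 0, the kernel is the transform of
  the indicator of the interval between 0 and t.\<close>

lemma lfsm_kernel_Lp: "(\<lambda>x. (max (t - x) 0) powr d - (max (- x) 0) powr d) \<in> Lp_fun lebesgue \<alpha>"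
proof -
  have G: "Gamma (d + 1) \<noteq> 0" using Gamma_real_pos[of "d + 1"] d_pos by linarith
  show ?thesis
  proof (cases "0 \<le> t")
    case True
    \<comment> \<open>The second term, with coefficient 0, only puts a scalar multiple into the
      two-term form of \<open>Lp_fun_lincomb\<close>.\<close>
    have "(\<lambda>x. Gamma (d + 1) * RL_minus d (indicator {0<..t}) x + 0 * RL_minus d (indicator {0<..t}) x) \<in> Lp_fun lebesgue \<alpha>"
      by (rule Lp_fun_lincomb[OF alpha_pos RL_minus_indicator_Lp RL_minus_indicator_Lp])
    then show ?thesis using G by (simp add: RL_minus_indicator[OF d_pos True])
  next
    case False
    then have t: "t \<le> 0" by simp
    have "(\<lambda>x. - Gamma (d + 1) * RL_minus d (indicator {t<..0}) x + 0 * RL_minus d (indicator {t<..0}) x) \<in> Lp_fun lebesgue \<alpha>"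
      by (rule Lp_fun_lincomb[OF alpha_pos RL_minus_indicator_Lp RL_minus_indicator_Lp])
    then show ?thesis using G by (simp add: RL_minus_indicator[OF d_pos t])
  qed
qed

lemma lfsm_measurable: "lfsm SI d t \<in> borel_measurable P"
  using SI_measurable[OF lfsm_kernel_Lp[of t]] unfolding lfsm_def by measurable

text \<open>The term in max (- x) 0 is common to both kernels and cancels in the difference, which
  leaves the transform of the indicator.\<close>

lemma lfsm_increment:
  assumes "s \<le> t"
  shows "AE \<omega> in P. lfsm SI d t \<omega> - lfsm SI d s \<omega> = SI (RL_minus d (indicator {s<..t})) \<omega>"
proof -
  define G where "G = Gamma (d + 1)"
  have eq: "RL_minus d (indicator {s<..t}) = (\<lambda>x. 1 / G * ((max (t - x) 0) powr d - (max (- x) 0) powr d)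
      + (- 1 / G) * ((max (s - x) 0) powr d - (max (- x) 0) powr d))"
    by (rule ext) (simp add: RL_minus_indicator[OF d_pos assms] G_def diff_divide_distrib)
  show ?thesis
    unfolding eq using SI_lincomb[OF lfsm_kernel_Lp[of t] lfsm_kernel_Lp[of s], of "1 / G" "- 1 / G"]
    by eventually_elim (simp add: lfsm_def G_def)
qed

lemma simple_integral_lfsm:
  assumes "\<phi> \<in> simple_data"
  shows "RL_minus d (simple_fun \<phi>) \<in> Lp_fun lebesgue \<alpha>"
    and "simple_integral (lfsm SI d) \<phi> \<in> borel_measurable P"
    and "AE \<omega> in P. simple_integral (lfsm SI d) \<phi> \<omega> = SI (RL_minus d (simple_fun \<phi>)) \<omega>"
proof -
  obtain n a \<tau> where \<phi>: "\<phi> = (n, a, \<tau>)" by (cases \<phi>)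
  let ?h = "\<lambda>i. RL_minus d (indicator {\<tau> i<..\<tau> (Suc i)})"
  have sm: "strict_mono_on {1..n} \<tau>" using assms by (simp add: \<phi> simple_data_def)
  have le: "\<tau> i \<le> \<tau> (Suc i)" if "i \<in> {1..<n}" for i
    using strict_mono_onD[OF sm, of i "Suc i"] that by auto
  have eq: "RL_minus d (simple_fun \<phi>) = (\<lambda>x. \<Sum>i\<in>{1..<n}. a i * ?h i x)"
    unfolding \<phi> by (rule ext) (rule RL_minus_simple_fun[OF d_pos])
  have si: "simple_integral (lfsm SI d) \<phi>
      = (\<lambda>\<omega>. \<Sum>i\<in>{1..<n}. a i * (lfsm SI d (\<tau> (Suc i)) \<omega> - lfsm SI d (\<tau> i) \<omega>))"
    unfolding \<phi> by (simp only: simple_integral_def prod.case)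
  note S = SI_sum[of "{1..<n}" ?h a, OF finite_atLeastLessThan RL_minus_indicator_Lp]
  show "RL_minus d (simple_fun \<phi>) \<in> Lp_fun lebesgue \<alpha>"
    unfolding eq using S by blast
  show "simple_integral (lfsm SI d) \<phi> \<in> borel_measurable P"
    unfolding si by (intro borel_measurable_sum borel_measurable_times borel_measurable_diff lfsm_measurable) simp
  have "AE \<omega> in P. \<forall>i\<in>{1..<n}. lfsm SI d (\<tau> (Suc i)) \<omega> - lfsm SI d (\<tau> i) \<omega> = SI (?h i) \<omega>"
    using lfsm_increment[OF le] by (intro AE_finite_allI) auto
  with conjunct2[OF S] show "AE \<omega> in P. simple_integral (lfsm SI d) \<phi> \<omega> = SI (RL_minus d (simple_fun \<phi>)) \<omega>"
    unfolding eq si by eventually_elim simp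
qed

lemma approx_seq_exists:
  assumes c: "0 < c" and f: "exp_dominated c t A f"
  shows "\<exists>\<phi>. approx_seq P L \<alpha> p d f \<phi>"
proof -
  obtain \<phi> where \<phi>: "\<And>k. \<phi> k \<in> simple_data"
    and dom: "\<And>k. exp_dominated c t (A + 1) (simple_fun (\<phi> k))"
    and lim: "AE x in lebesgue. (\<lambda>k. simple_fun (\<phi> k) x) \<longlonglongrightarrow> f x"
    using exp_dominated_step_approximation[OF c f] by metis
  \<comment> \<open>The constant adds the envelope A + 1 of the step functions to the envelope A of
    \<open>f\<close>.\<close>
  have "exp_dominated c t (A + 1 + A) (\<lambda>x. simple_fun (\<phi> k) x - f x)" for k
    unfolding exp_dominated_def
  proof (intro conjI allI)
    show "(\<lambda>x. simple_fun (\<phi> k) x - f x) \<in> borel_measurable lebesgue"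
      using borel_measurable_simple_fun f unfolding exp_dominated_def
      by (intro borel_measurable_diff) auto
    fix u
    have "\<bar>simple_fun (\<phi> k) u\<bar> \<le> (A + 1) * (exp (- c * (t - u)) * indicator {..t} u)"
      "\<bar>f u\<bar> \<le> A * (exp (- c * (t - u)) * indicator {..t} u)"
      using dom[of k] f unfolding exp_dominated_def by blast+
    then show "\<bar>simple_fun (\<phi> k) u - f u\<bar> \<le> (A + 1 + A) * (exp (- c * (t - u)) * indicator {..t} u)"
      unfolding distrib_right[of "A + 1" A] by linarith
  qed
  moreover have "AE x in lebesgue. (\<lambda>k. simple_fun (\<phi> k) x - f x) \<longlonglongrightarrow> 0"
    using lim by eventually_elim (auto intro: LIM_zero)
  ultimately have "(\<lambda>k. \<integral>x. \<bar>RL_minus d (\<lambda>x. simple_fun (\<phi> k) x - f x) x\<bar> powr \<alpha> \<partial>lebesgue) \<longlonglongrightarrow> 0"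
    by (rule RL_minus_dominated_convergence[OF d_pos d_lt_1 c alpha_pos alpha_d])
  then have "(\<lambda>k. (\<integral>x. \<bar>RL_minus d (\<lambda>x. simple_fun (\<phi> k) x - f x) x\<bar> powr \<alpha> \<partial>lebesgue) powr (1 / \<alpha>)) \<longlonglongrightarrow> 0"
    using alpha_pos by (intro tendsto_zero_powrI[where b="1 / \<alpha>"]) auto
  then have "approx_seq P L \<alpha> p d f \<phi>"
    unfolding approx_seq_def frac_norm_def using \<phi> by (auto intro: tendsto_mult_right_zero)
  then show ?thesis by blast
qed

text \<open>The approximating sequence is arbitrary and its step functions share no envelope. Each
  of them still has a convergent transform, so the transform of the error splits, and the p-th mean
  of the difference of the integrals is exactly the p-th power of the fractional norm.\<close>

lemma has_lfsm_integral_exp_dominated: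
  assumes p: "0 < p" "p < \<alpha>" and c: "0 < c" and f: "exp_dominated c t A f"
  shows "has_lfsm_integral P L SI \<alpha> p d f (SI (RL_minus d f))"
  unfolding has_lfsm_integral_def
proof (intro conjI allI impI)
  show "f \<in> Lp_fun lebesgue 1 \<inter> Lp_fun lebesgue \<alpha>"
    using exp_dominated_Lp[OF c _ f] alpha_pos by auto
  show "\<exists>\<phi>. approx_seq P L \<alpha> p d f \<phi>" by (rule approx_seq_exists[OF c f])
next
  fix \<phi> assume \<phi>: "approx_seq P L \<alpha> p d f \<phi>"
  define X where "X = (\<lambda>k. simple_integral (lfsm SI d) (\<phi> k))"
  define h where "h k = (\<lambda>x. simple_fun (\<phi> k) x - f x)" for k
  have sd: "\<phi> k \<in> simple_data" for k using \<phi> by (simp add: approx_seq_def)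
  note S = simple_integral_lfsm[OF sd]
  have If: "RL_minus d f \<in> Lp_fun lebesgue \<alpha>" by (rule RL_minus_Lp[OF c f])
  have [measurable]: "X k \<in> borel_measurable P" "SI (RL_minus d f) \<in> borel_measurable P" for k
    using S(2) SI_measurable[OF If] by (simp_all add: X_def)
  have Ih: "RL_minus d (h k) = (\<lambda>x. 1 * RL_minus d (simple_fun (\<phi> k)) x + (- 1) * RL_minus d f x)" for k
    unfolding h_def
    by (rule ext) (simp add: RL_minus_diff[OF RL_integrable_simple_fun[OF d_pos] exp_dominated_RL_integrable[OF d_pos c f]])
  have IhLp: "RL_minus d (h k) \<in> Lp_fun lebesgue \<alpha>" for k
    unfolding Ih by (rule Lp_fun_lincomb[OF alpha_pos S(1) If])
  have diff: "AE \<omega> in P. X k \<omega> - SI (RL_minus d f) \<omega> = SI (RL_minus d (h k)) \<omega>" for k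
    unfolding Ih using SI_lincomb[OF S(1)[of k] If, of 1 "- 1"] S(3)[of k]
    by eventually_elim (simp add: X_def)
  have "(\<integral>\<omega>. \<bar>X k \<omega> - SI (RL_minus d f) \<omega>\<bar> powr p \<partial>P) = frac_norm P L \<alpha> p d (h k) powr p" for k
  proof -
    have "(\<integral>\<omega>. \<bar>X k \<omega> - SI (RL_minus d f) \<omega>\<bar> powr p \<partial>P) = (\<integral>\<omega>. \<bar>SI (RL_minus d (h k)) \<omega>\<bar> powr p \<partial>P)"
      using diff[of k] SI_measurable[OF IhLp[of k]] by (intro integral_cong_AE) auto
    also have "\<dots> = frac_norm P L \<alpha> p d (h k) powr p"
      unfolding SI_moment(2)[OF p IhLp] frac_norm_def using p by (simp add: powr_mult powr_powr)
    finally show ?thesis .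
  qed
  moreover have "(\<lambda>k. frac_norm P L \<alpha> p d (h k) powr p) \<longlonglongrightarrow> 0"
    using \<phi> p unfolding approx_seq_def h_def
    by (intro tendsto_zero_powrI[where b=p]) (auto simp: frac_norm_def)
  ultimately have "(\<lambda>k. \<integral>\<omega>. \<bar>X k \<omega> - SI (RL_minus d f) \<omega>\<bar> powr p \<partial>P) \<longlonglongrightarrow> 0"
    by simp
  moreover have "X k \<in> Lp_fun P p" for k
    using Lp_fun_cong_AE[OF S(2) SI_moment(1)[OF p S(1)] S(3)] by (simp add: X_def)
  ultimately show "Lp_tendsto P p (\<lambda>k. simple_integral (lfsm SI d) (\<phi> k)) (SI (RL_minus d f))"
    unfolding Lp_tendsto_def X_def using SI_moment(1)[OF p If] by simp
qed

end

section \<open>The FIMA process\<close>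

lemma exp_dominated_reflect:
  assumes g: "g \<in> borel_measurable lebesgue" and bound: "\<And>v. \<bar>g v\<bar> \<le> C * exp (- c * v)"
  shows "exp_dominated c t C (\<lambda>x. g (t - x) * indicator {..t} x)"
  unfolding exp_dominated_def
proof (intro conjI allI)
  \<comment> \<open>Composing a Lebesgue measurable function with a Borel map may destroy
    measurability, so the reflection has to be measurable from \<open>lebesgue\<close> to
    \<open>lebesgue\<close>.\<close>
  have m: "(\<lambda>u. t + - 1 * u) \<in> lebesgue \<rightarrow>\<^sub>M (lebesgue :: real measure)"
    using lebesgue_affine_measurable[where c="\<lambda>_::real. -1" and t=t] by simp
  have "(\<lambda>x. g (t - x)) \<in> borel_measurable lebesgue"
    using measurable_compose[OF m g] by simp
  then show "(\<lambda>x. g (t - x) * indicator {..t} x) \<in> borel_measurable lebesgue"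
    by (intro borel_measurable_times) (auto intro!: measurable_completion)
  show "\<bar>g (t - u) * indicator {..t} u\<bar> \<le> C * (exp (- c * (t - u)) * indicator {..t} u)" for u
    using bound[of "t - u"] by (simp add: indicator_def)
qed

theorem theorem4p2:
  fixes P :: "'w measure"
    and L :: "real \<Rightarrow> 'w \<Rightarrow> real"
    and SI :: "(real \<Rightarrow> real) \<Rightarrow> 'w \<Rightarrow> real"
    and g :: "real \<Rightarrow> real"
    and \<alpha> d p C c :: real
  assumes "1 < \<alpha>" and "\<alpha> < 2"
    and "0 < d" and "d < 1 - 1 / \<alpha>"
    and "1 < p" and "p < \<alpha>"
    and "SaS_process P \<alpha> L"
    and "stable_integral P \<alpha> L SI"
    and "g \<in> borel_measurable lebesgue"
    and "\<And>t. t < 0 \<Longrightarrow> g t = 0"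
    and "0 < C" and "0 < c"
    and "\<And>t. \<bar>g t\<bar> \<le> C * exp (- c * t)"
  shows "\<forall>t. has_lfsm_integral P L SI \<alpha> p d (\<lambda>x. g (t - x) * indicator {..t} x) (fima SI d g t)"
proof
  fix t
  interpret prob_space P using assms(7) by (simp add: SaS_process_def)
  interpret fractional_stable_noise P \<alpha> L SI d
    using assms by unfold_locales auto
  \<comment> \<open>The identity holds at every point, so the two integrands are the same argument
    of \<open>SI\<close>.\<close>
  have "RL_minus d (\<lambda>x. g (t - x) * indicator {..t} x) = (\<lambda>x. RL_plus d g (t - x) * indicator {..t} x)"
    by (rule ext) (rule RL_minus_reflect[OF assms(9,10)])
  then have "fima SI d g t = SI (RL_minus d (\<lambda>x. g (t - x) * indicator {..t} x))"
    by (simp add: fima_def)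
  then show "has_lfsm_integral P L SI \<alpha> p d (\<lambda>x. g (t - x) * indicator {..t} x) (fima SI d g t)"
    using has_lfsm_integral_exp_dominated[OF _ assms(6,12) exp_dominated_reflect[OF assms(9,13)]] assms(5)
    by simp
qed

end
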